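(* Let $m>2$, let $A=B=C=\mathbb{C}^m$, and let $T\in A\otimes B\otimes C$ be a tensor of border rank $m$. Suppose that $T$ is $1_A$-generic, that $\mathbb{P}T(A^* )\cap \mathrm{Seg}(\mathbb{P}B\times\mathbb{P}C)=[X]$ is a single point, and that $\mathbb{P}\hat T_{[X]}\mathrm{Seg}(\mathbb{P}B\times\mathbb{P}C)\cap\mathbb{P}T(A^* )$ is a $\mathbb{P}^{m-2}$. Then $T$ is isomorphic to the Coppersmith-Winograd tensor $\tilde T_{m-2,CW}$.
   Context: All vector spaces are over $\mathbb{C}$. A tensor $T\in A\otimes B\otimes C$ is viewed as a linear map $T:A^*\to B\otimes C\simeq \mathrm{Hom}(C^*,B)$, with image $T(A^* )$. The rank of $T$ is the least $r$ such that $T$ is a sum of $r$ tensors of the form $a\otimes b\otimes c$; the border rank $\underline{\mathbf R}(T)$ is the least $r$ such that $T$ is a limit of tensors of rank $r$ (equivalently, lies in the Zariski closure of the set of such tensors). When $\dim B=\dim C=m$, $T$ is $1_A$-generic if $T(A^* )$ contains an element of rank $m$. $\mathrm{Seg}(\mathbb{P}B\times\mathbb{P}C)\subset\mathbb{P}(B\otimes C)$ is the Segre variety of rank one elements, and $\hat T_{[X]}\mathrm{Seg}(\mathbb{P}B\times\mathbb{P}C)\subset B\otimes C$ is its affine tangent space at $[X]$ (for $X=b\otimes c$ it is $b\otimes C+B\otimes c$). Two tensors $T,T'\in\mathbb{C}^m\otimes\mathbb{C}^m\otimes\mathbb{C}^m$ are isomorphic if there exist $g\in GL(A)\times GL(B)\times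 GL(C)$ and $\sigma\in\mathfrak{S}_3$ (permuting the three factors) with $\sigma(g(T))=T'$. The Coppersmith-Winograd tensor is $$\tilde T_{q,CW}=\sum_{j=1}^q (a_0\otimes b_j\otimes c_j+a_j\otimes b_0\otimes c_j+a_j\otimes b_j\otimes c_0)+a_0\otimes b_0\otimes c_{q+1}+a_0\otimes b_{q+1}\otimes c_0+a_{q+1}\otimes b_0\otimes c_0\in\mathbb{C}^{q+2}\otimes\mathbb{C}^{q+2}\otimes\mathbb{C}^{q+2},$$ where $\{a_j\},\{b_j\},\{c_j\}$, $0\le j\le q+1$, are bases of the three factors. *)

theory Defs
  imports "HOL-Analysis.Analysis"
begin

section \<open>Tensors, rank and border rank\<close>

text \<open>
  An element of the tensor product of \<open>A\<close>, \<open>B\<close>, \<open>C\<close>, with \<open>A\<close>, \<open>B\<close>, \<open>C\<close> the coordinate spaces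
  indexed by \<open>'a\<close>, \<open>'b\<close>, \<open>'c\<close>, is given by its coefficients \<open>T $ i $ j $ k\<close> in the standard bases.
  An element of the tensor product of \<open>B\<close> and \<open>C\<close> is a matrix with rows indexed by \<open>'b\<close> and
  columns indexed by \<open>'c\<close>.
\<close>

type_synonym ('a, 'b, 'c) tensor = "((complex ^ 'c) ^ 'b) ^ 'a"

definition tensor3 ::
    "complex ^ 'a \<Rightarrow> complex ^ 'b \<Rightarrow> complex ^ 'c \<Rightarrow> ('a, 'b, 'c) tensor" where
  "tensor3 a b c = (\<chi> i j k. a $ i * b $ j * c $ k)"

definition tensor2 :: "complex ^ 'b \<Rightarrow> complex ^ 'c \<Rightarrow> (complex ^ 'c) ^ 'b" where
  "tensor2 b c = (\<chi> j k. b $ j * c $ k)"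

definition tensor_rank :: "('a::finite, 'b::finite, 'c::finite) tensor \<Rightarrow> nat" where
  "tensor_rank T = (LEAST r. \<exists>a b c. T = (\<Sum>l<r. tensor3 (a l) (b l) (c l)))"

definition border_rank :: "('a::finite, 'b::finite, 'c::finite) tensor \<Rightarrow> nat" where
  "border_rank T = (LEAST r. T \<in> closure {S. tensor_rank S = r})"

text \<open>The sets over which the two minima are taken are nonempty.\<close>

lemma ex_tensor_decomposition:
  fixes T :: "('a::finite, 'b::finite, 'c::finite) tensor"
  shows "\<exists>r a b c. T = (\<Sum>l<r::nat. tensor3 (a l) (b l) (c l))"
proof -
  obtain f :: "nat \<Rightarrow> 'a \<times> 'b \<times> 'c" where
    f: "bij_betw f {..<card (UNIV :: ('a \<times> 'b \<times> 'c) set)} UNIV"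
    using ex_bij_betw_nat_finite[OF finite[of "UNIV :: ('a \<times> 'b \<times> 'c) set"]]
    by (auto simp: atLeast0LessThan)
  let ?g = "\<lambda>(p, q, s). tensor3 (axis p (T $ p $ q $ s)) (axis q 1) (axis s 1)"
  have 1: "(if i = p then x else 0) * (if j = q then 1 else 0) * (if k = s then 1 else 0)
      = (if i = p then if j = q then if k = s then x else 0 else 0 else 0)"
    for x :: complex and i p :: 'a and j q :: 'b and k s :: 'c by simp
  have "(\<Sum>t\<in>UNIV. ?g t) = T"
  proof (simp add: vec_eq_iff, intro allI)
    fix i j k
    have "(\<Sum>t\<in>UNIV. ?g t $ i $ j $ k) =
        (\<Sum>p\<in>UNIV. \<Sum>q\<in>UNIV. \<Sum>s\<in>UNIV.
          if i = p then if j = q then if k = s then T $ p $ q $ s else 0 else 0 else 0)"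
      by (simp add: UNIV_Times_UNIV[symmetric] sum.cartesian_product tensor3_def axis_def 1
          split_beta del: UNIV_Times_UNIV)
    also have "\<dots> = (\<Sum>p\<in>UNIV. if i = p then T $ p $ j $ k else 0)"
    proof (intro sum.cong refl)
      fix p
      have "(\<Sum>q\<in>UNIV. \<Sum>s\<in>UNIV. if j = q then if k = s then T $ p $ q $ s else 0 else 0) =
          (\<Sum>q\<in>UNIV. if j = q then T $ p $ q $ k else 0)"
        by (intro sum.cong refl) simp
      then show "(\<Sum>q\<in>UNIV. \<Sum>s\<in>UNIV.
          if i = p then if j = q then if k = s then T $ p $ q $ s else 0 else 0 else 0) =
          (if i = p then T $ p $ j $ k else 0)"
        by simp
    qed
    also have "\<dots> = T $ i $ j $ k" by simp
    finally show "(\<Sum>t\<in>UNIV. ?g t $ i $ j $ k) = T $ i $ j $ k" .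
  qed
  then have "T = (\<Sum>l<card (UNIV :: ('a \<times> 'b \<times> 'c) set). ?g (f l))"
    using sum.reindex_bij_betw[OF f, of ?g] by simp
  then have "T = (\<Sum>l<card (UNIV :: ('a \<times> 'b \<times> 'c) set).
      tensor3 (axis (fst (f l)) (T $ fst (f l) $ fst (snd (f l)) $ snd (snd (f l))))
        (axis (fst (snd (f l))) 1) (axis (snd (snd (f l))) 1))"
    by (simp add: split_beta)
  then show ?thesis by (intro exI)
qed

lemma ex_border_rank: "\<exists>r. T \<in> closure {S. tensor_rank S = r}"
  by (rule exI[of _ "tensor_rank T"]) (simp add: closure_def)

section \<open>The image of the dual space\<close>

text \<open>
  For a linear functional \<open>\<alpha>\<close> on \<open>A\<close>, entry \<open>(j, k)\<close> of \<open>T(\<alpha>)\<close> is \<open>\<alpha>\<close> applied to the vector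
  of the \<open>T $ i $ j $ k\<close>; this sends \<open>tensor3 a b c\<close> to \<open>\<alpha> a\<close> times \<open>tensor2 b c\<close>.
\<close>

definition contract ::
    "('a, 'b, 'c) tensor \<Rightarrow> (complex ^ 'a \<Rightarrow> complex) \<Rightarrow> (complex ^ 'c) ^ 'b" where
  "contract T \<alpha> = (\<chi> j k. \<alpha> (\<chi> i. T $ i $ j $ k))"

definition tensor_image ::
    "('a::finite, 'b, 'c) tensor \<Rightarrow> ((complex ^ 'c) ^ 'b) set" where
  "tensor_image T = {contract T \<alpha> | \<alpha>. Vector_Spaces.linear (*s) (*) \<alpha>}"

definition one_A_generic :: "('a::finite, 'm::finite, 'm) tensor \<Rightarrow> bool" where
  "one_A_generic T \<longleftrightarrow> (\<exists>M \<in> tensor_image T. rank M = CARD('m))"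

section \<open>Projective geometry of matrices\<close>

definition mat_scale :: "complex \<Rightarrow> (complex ^ 'c) ^ 'b \<Rightarrow> (complex ^ 'c) ^ 'b" where
  "mat_scale z M = (\<chi> j k. z * M $ j $ k)"

interpretation matsp: vector_space mat_scale
  by unfold_locales (simp_all add: mat_scale_def vec_eq_iff algebra_simps)

text \<open>Points of the projective space are the lines through 0, as sets of matrices.\<close>

definition proj_point :: "(complex ^ 'c) ^ 'b \<Rightarrow> ((complex ^ 'c) ^ 'b) set" where
  "proj_point M = matsp.span {M}"

definition projectivization ::
    "((complex ^ 'c) ^ 'b) set \<Rightarrow> ((complex ^ 'c) ^ 'b) set set" where
  "projectivization V = proj_point ` (V - {0})"

definition is_linear_proj_space ::
    "nat \<Rightarrow> ((complex ^ 'c) ^ 'b) set set \<Rightarrow> bool" where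
  "is_linear_proj_space d L \<longleftrightarrow>
    (\<exists>W. matsp.subspace W \<and> matsp.dim W = d + 1 \<and> L = projectivization W)"

definition segre :: "((complex ^ 'c) ^ 'b) set set" where
  "segre = {proj_point (tensor2 b c) | b c. b \<noteq> 0 \<and> c \<noteq> 0}"

text \<open>
  Affine tangent space to the Segre variety at the point \<open>[X]\<close>, for \<open>X\<close> of rank one. It does not
  depend on how \<open>X\<close> is written as \<open>tensor2 b c\<close>, see \<open>segre_tangent_tensor2\<close>.
\<close>

definition segre_tangent :: "(complex ^ 'c) ^ 'b \<Rightarrow> ((complex ^ 'c) ^ 'b) set" where
  "segre_tangent X =
    {tensor2 b c' + tensor2 b' c | b c b' c'. b \<noteq> 0 \<and> c \<noteq> 0 \<and> X = tensor2 b c}"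

lemma tensor2_eq_imp_scaled:
  assumes eq: "tensor2 b c = tensor2 b1 c1" and "b \<noteq> 0" "c \<noteq> 0"
  obtains z w where "b = z *s b1" "c = w *s c1"
proof -
  have e: "b $ j * c $ k = b1 $ j * c1 $ k" for j k
    using eq by (simp add: tensor2_def vec_eq_iff)
  obtain p where p: "b $ p \<noteq> 0" using \<open>b \<noteq> 0\<close> by (auto simp: vec_eq_iff)
  obtain q where q: "c $ q \<noteq> 0" using \<open>c \<noteq> 0\<close> by (auto simp: vec_eq_iff)
  have "b = (c1 $ q / c $ q) *s b1"
    using e[of _ q] q by (simp add: vec_eq_iff field_simps)
  moreover have "c = (b1 $ p / b $ p) *s c1"
    using e[of p] p by (simp add: vec_eq_iff field_simps)
  ultimately show ?thesis using that by blast
qed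

lemma segre_tangent_tensor2:
  assumes "b \<noteq> 0" "c \<noteq> 0"
  shows "segre_tangent (tensor2 b c) = {tensor2 b c' + tensor2 b' c | b' c'. True}"
    (is "_ = ?R")
proof
  show "?R \<subseteq> segre_tangent (tensor2 b c)"
    using assms unfolding segre_tangent_def by blast
  show "segre_tangent (tensor2 b c) \<subseteq> ?R"
  proof
    fix Y assume "Y \<in> segre_tangent (tensor2 b c)"
    then obtain b1 c1 b' c' where 1: "b1 \<noteq> 0" "c1 \<noteq> 0" "tensor2 b1 c1 = tensor2 b c"
      and Y: "Y = tensor2 b1 c' + tensor2 b' c1"
      unfolding segre_tangent_def by auto
    obtain z w where "b1 = z *s b" "c1 = w *s c"
      using tensor2_eq_imp_scaled[OF 1(3,1,2)] .
    then have "Y = tensor2 b (z *s c') + tensor2 (w *s b') c"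
      by (simp add: Y tensor2_def vec_eq_iff algebra_simps)
    then show "Y \<in> ?R" by blast
  qed
qed

section \<open>Isomorphism of tensors\<close>

definition gl_act ::
    "complex ^ 'm ^ 'm \<Rightarrow> complex ^ 'm ^ 'm \<Rightarrow> complex ^ 'm ^ 'm \<Rightarrow>
      ('m::finite, 'm, 'm) tensor \<Rightarrow> ('m, 'm, 'm) tensor" where
  "gl_act g h k T =
    (\<chi> i j l. \<Sum>p\<in>UNIV. \<Sum>q\<in>UNIV. \<Sum>s\<in>UNIV. g $ i $ p * h $ j $ q * k $ l $ s * T $ p $ q $ s)"

definition permute_factors ::
    "(nat \<Rightarrow> nat) \<Rightarrow> ('m::finite, 'm, 'm) tensor \<Rightarrow> ('m, 'm, 'm) tensor" where
  "permute_factors \<sigma> T =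
    (\<chi> i j k. T $ ([i, j, k] ! \<sigma> 0) $ ([i, j, k] ! \<sigma> 1) $ ([i, j, k] ! \<sigma> 2))"

definition tensor_isomorphic ::
    "('m::finite, 'm, 'm) tensor \<Rightarrow> ('m, 'm, 'm) tensor \<Rightarrow> bool" where
  "tensor_isomorphic T T' \<longleftrightarrow>
    (\<exists>g h k \<sigma>. invertible g \<and> invertible h \<and> invertible k \<and> \<sigma> permutes {0, 1, 2} \<and>
      permute_factors \<sigma> (gl_act g h k T) = T')"

lemma gl_act_tensor3: "gl_act g h k (tensor3 a b c) = tensor3 (g *v a) (h *v b) (k *v c)"
  by (simp add: gl_act_def tensor3_def matrix_vector_mult_def vec_eq_iff
      sum_distrib_left sum_distrib_right mult_ac) (intro allI sum.swap)

section \<open>The Coppersmith-Winograd tensor\<close>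

definition indexed_basis :: "nat \<Rightarrow> (nat \<Rightarrow> complex ^ 'm) \<Rightarrow> bool" where
  "indexed_basis n v \<longleftrightarrow>
    inj_on v {..<n} \<and> vec.independent (v ` {..<n}) \<and> vec.span (v ` {..<n}) = UNIV"

definition cw_tensor ::
    "nat \<Rightarrow> (nat \<Rightarrow> complex ^ 'm) \<Rightarrow> (nat \<Rightarrow> complex ^ 'm) \<Rightarrow> (nat \<Rightarrow> complex ^ 'm) \<Rightarrow>
      ('m::finite, 'm, 'm) tensor" where
  "cw_tensor q a b c =
    (\<Sum>j=1..q. tensor3 (a 0) (b j) (c j) + tensor3 (a j) (b 0) (c j) + tensor3 (a j) (b j) (c 0))
    + tensor3 (a 0) (b 0) (c (q+1)) + tensor3 (a 0) (b (q+1)) (c 0) + tensor3 (a (q+1)) (b 0) (c 0)"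

end

theory Submission
  imports Defs
begin

text \<open>
  Since \<open>T\<close> is a limit of tensors of rank \<open>m\<close> and \<open>E = T(A\<^sup>*)\<close> contains an invertible \<open>M\<^sub>0\<close>,
  with inverse \<open>N\<close>, one has \<open>M N M' = M' N M\<close> on \<open>E\<close> (Strassen). Write \<open>X = b \<otimes> c\<close>, let \<open>W\<close> be
  the hyperplane of elements \<open>b \<otimes> c' + b' \<otimes> c\<close> of \<open>E\<close>, and pair \<open>C\<close> with \<open>B\<close> through \<open>N\<close>.
  Commutation forces \<open>\<langle>c, b\<rangle> = 0\<close> and, since \<open>[X]\<close> is the only rank one point,
  \<open>\<langle>c, b'\<rangle> = \<langle>c', b\<rangle> = 0\<close>. Hence \<open>M\<^sub>1 N M\<^sub>2 = \<langle>c\<^sub>1, b\<^sub>2\<rangle> X\<close> on \<open>W\<close>, a symmetric bilinear form whose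
  radical is spanned by \<open>X\<close>. An orthonormal basis of \<open>W\<close> modulo \<open>X\<close> gives the vectors
  \<open>b\<^sub>j, c\<^sub>j\<close>; completing them to dual bases for the pairing, \<open>M\<^sub>0 = N\<^sup>-\<^sup>1\<close> becomes
  the remaining slice of the Coppersmith-Winograd tensor.
\<close>

section \<open>Strassen's equations\<close>

text \<open>A functional is replaced by its coordinate vector \<open>w\<close>, so for fixed
  \<open>w\<close> every entry depends linearly, hence continuously, on the entries of
  \<open>T\<close>.\<close>

definition slice_comb :: "complex ^ 'a \<Rightarrow> ('a::finite, 'b, 'c) tensor \<Rightarrow> (complex ^ 'c) ^ 'b" where
  "slice_comb w T = (\<chi> j k. \<Sum>i\<in>UNIV. w $ i * T $ i $ j $ k)"

lemma linear_functional_eq_sum: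
  fixes \<alpha> :: "complex ^ 'a::finite \<Rightarrow> complex"
  assumes "Vector_Spaces.linear (*s) (*) \<alpha>"
  shows "\<alpha> x = (\<Sum>i\<in>UNIV. \<alpha> (axis i 1) * x $ i)"
proof -
  interpret \<alpha>: Vector_Spaces.linear "(*s)" "(*)" \<alpha> by fact
  have "\<alpha> x = \<alpha> (\<Sum>i\<in>UNIV. x $ i *s axis i 1)" by (simp add: basis_expansion)
  also have "\<dots> = (\<Sum>i\<in>UNIV. \<alpha> (axis i 1) * x $ i)"
    by (simp add: \<alpha>.sum \<alpha>.scale mult.commute)
  finally show ?thesis .
qed

lemma tensor_image_eq_range: "tensor_image T = range (\<lambda>w. slice_comb w T)"
proof
  show "tensor_image T \<subseteq> range (\<lambda>w. slice_comb w T)"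
  proof
    fix M assume "M \<in> tensor_image T"
    then obtain \<alpha> where \<alpha>: "Vector_Spaces.linear (*s) (*) \<alpha>" "M = contract T \<alpha>"
      by (auto simp: tensor_image_def)
    have "M = slice_comb (\<chi> i. \<alpha> (axis i 1)) T"
      unfolding \<alpha>(2) contract_def slice_comb_def
      by (subst linear_functional_eq_sum[OF \<alpha>(1)]) simp
    then show "M \<in> range (\<lambda>w. slice_comb w T)" by blast
  qed
  show "range (\<lambda>w. slice_comb w T) \<subseteq> tensor_image T"
  proof
    fix M assume "M \<in> range (\<lambda>w. slice_comb w T)"
    then obtain w where w: "M = slice_comb w T" by blast
    have "Vector_Spaces.linear (*s) (*) (\<lambda>x. \<Sum>i\<in>UNIV. w $ i * x $ i)"
      by unfold_locales (simp_all add: algebra_simps sum.distrib sum_distrib_left)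
    moreover have "M = contract T (\<lambda>x. \<Sum>i\<in>UNIV. w $ i * x $ i)"
      by (simp add: w slice_comb_def contract_def)
    ultimately show "M \<in> tensor_image T" unfolding tensor_image_def by blast
  qed
qed

lemma slice_comb_sum_tensor3:
  "slice_comb w (\<Sum>l\<in>L. tensor3 (a l) (b l) (c l)) =
    (\<Sum>l\<in>L. mat_scale (\<Sum>i\<in>UNIV. w $ i * a l $ i) (tensor2 (b l) (c l)))"
proof -
  have "(\<Sum>i\<in>UNIV. w $ i * (\<Sum>l\<in>L. a l $ i * b l $ j * c l $ k)) =
     (\<Sum>l\<in>L. (\<Sum>i\<in>UNIV. w $ i * a l $ i) * (b l $ j * c l $ k))" for j k
    by (simp add: sum_distrib_left sum_distrib_right mult_ac) (rule sum.swap)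
  then show ?thesis
    by (simp add: slice_comb_def tensor3_def mat_scale_def tensor2_def vec_eq_iff)
qed

lemma full_rank_imp_invertible:
  fixes M :: "complex ^ 'm ^ 'm::finite"
  assumes "rank M = CARD('m)"
  shows "invertible M"
proof -
  have "vec.dim (rows M) = vec.dimension TYPE(complex) TYPE('m)"
    using assms by (simp add: row_rank_def_gen card_cart_basis vec.dimension_def)
  then have "vec.span (rows M) = UNIV" by (simp add: vec.dim_eq_full)
  then show ?thesis
    by (simp add: invertible_left_inverse matrix_left_invertible_span_rows_gen)
qed

section \<open>Adjugates and continuity of polynomial matrix expressions\<close>

lemma mat_scale_simps [simp]:
  "mat_scale z M $ j $ k = z * M $ j $ k" "mat_scale z A ** B = mat_scale z (A ** B)"
  "A ** mat_scale z B = mat_scale z (A ** B)" "mat_scale z A *v x = z *s (A *v x)"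
  by (simp_all add: mat_scale_def matrix_matrix_mult_def matrix_vector_mult_def vec_eq_iff
      sum_distrib_left mult_ac)

text \<open>Cramer's form of the classical adjugate. It is polynomial in the entries and makes sense
  for singular matrices, so it can stand in for an inverse under limits.\<close>

definition adjugate :: "'a::field ^ 'm ^ 'm \<Rightarrow> 'a ^ 'm ^ 'm::finite" where
  "adjugate M = (\<chi> k r. det (\<chi> i l. if l = k then axis r 1 $ i else M $ i $ l))"

lemma adjugate_eq_det_inverse:
  fixes M N :: "complex ^ 'm ^ 'm::finite"
  assumes "M ** N = mat 1"
  shows "adjugate M = mat_scale (det M) N"
proof -
  have d: "det M \<noteq> 0"
    using assms invertible_det_nz invertible_right_inverse by blast
  have "(\<chi> k. N $ k $ r) = (\<chi> k. det (\<chi> i j. if j = k then axis r 1 $ i else M $ i $ j) / det M)" for r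
  proof -
    have "M *v (\<chi> k. N $ k $ r) = axis r 1"
      using assms by (auto simp: matrix_vector_mult_def matrix_matrix_mult_def vec_eq_iff mat_def axis_def)
    then show ?thesis using cramer[OF d] by blast
  qed
  then show ?thesis
    using d by (simp add: adjugate_def vec_eq_iff field_simps)
qed

lemma continuous_on_det:
  fixes M :: "'x::topological_space \<Rightarrow> complex ^ 'm ^ 'm::finite"
  assumes "\<And>i j. continuous_on S (\<lambda>x. M x $ i $ j)"
  shows "continuous_on S (\<lambda>x. det (M x))"
  unfolding det_def by (intro continuous_intros assms)

lemma continuous_on_adjugate_entry:
  fixes M :: "'x::topological_space \<Rightarrow> complex ^ 'm ^ 'm::finite"
  assumes "\<And>i j. continuous_on S (\<lambda>x. M x $ i $ j)"
  shows "continuous_on S (\<lambda>x. adjugate (M x) $ k $ r)"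
proof -
  have "continuous_on S (\<lambda>x. if l = k then c else M x $ i $ l)" for i l k and c :: complex
    by (cases "l = k") (simp_all add: assms)
  then show ?thesis
    unfolding adjugate_def vec_lambda_beta
    by (intro continuous_on_det) simp
qed

lemma continuous_on_matrix_mult_entry:
  fixes M :: "'x::topological_space \<Rightarrow> complex ^ 'n::finite ^ 'm"
    and N :: "'x \<Rightarrow> complex ^ 'p ^ 'n"
  assumes "\<And>i j. continuous_on S (\<lambda>x. M x $ i $ j)" "\<And>i j. continuous_on S (\<lambda>x. N x $ i $ j)"
  shows "continuous_on S (\<lambda>x. (M x ** N x) $ i $ j)"
  unfolding matrix_matrix_mult_def vec_lambda_beta by (intro continuous_intros assms)

text \<open>The \<open>b l\<close> become the columns of \<open>B\<close> and the \<open>c l\<close>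
  the rows of \<open>C\<close>, so only the diagonal factor depends on \<open>w\<close>. Having
  exactly \<open>CARD('m)\<close> summands makes all factors square.\<close>

lemma slice_comb_factor:
  fixes b c :: "nat \<Rightarrow> complex ^ 'm::finite" and a :: "nat \<Rightarrow> complex ^ 'a::finite"
  obtains B :: "complex ^ 'm ^ 'm" and C :: "complex ^ 'm ^ 'm" and d :: "complex ^ 'a \<Rightarrow> 'm \<Rightarrow> complex"
  where "\<And>w. slice_comb w (\<Sum>l<CARD('m). tensor3 (a l) (b l) (c l)) = B ** (\<chi> i j. if i = j then d w i else 0) ** C"
proof -
  obtain f :: "'m \<Rightarrow> nat" where "bij_betw f UNIV {0..<CARD('m)}"
    using ex_bij_betw_finite_nat[of "UNIV :: 'm set"] by auto
  then have f: "bij_betw f UNIV {..<CARD('m)}" by (simp add: atLeast0LessThan)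
  show thesis
  proof (rule that)
    fix w
    show "slice_comb w (\<Sum>l<CARD('m). tensor3 (a l) (b l) (c l)) =
       (\<chi> j l. b (f l) $ j) ** (\<chi> i j. if i = j then \<Sum>p\<in>UNIV. w $ p * a (f i) $ p else 0) ** (\<chi> l k. c (f l) $ k)"
      unfolding slice_comb_sum_tensor3 sum.reindex_bij_betw[OF f, symmetric]
      by (simp add: vec_eq_iff matrix_matrix_mult_def mat_scale_def tensor2_def
          if_distrib[of "\<lambda>x. _ * x"] mult_ac cong: if_cong)
  qed
qed

text \<open>On tensors of rank at most \<open>m\<close> the slices factor as \<open>B D C\<close> with \<open>D\<close> diagonal, so the
  products \<open>M\<^sub>1 M\<^sub>0\<^sup>-\<^sup>1 M\<^sub>2\<close> are symmetric in \<open>M\<^sub>1\<close> and \<open>M\<^sub>2\<close>. Multiplied by \<open>det M\<^sub>0\<close> twice this is a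
  polynomial identity without inverses, hence it survives in the closure.\<close>

lemma strassen_adjugate_rank:
  fixes T :: "('a::finite, 'm::finite, 'm) tensor"
  assumes "T = (\<Sum>l<CARD('m). tensor3 (a l) (b l) (c l))"
  shows "det (slice_comb w0 T) *
      ((slice_comb w1 T ** adjugate (slice_comb w0 T) ** slice_comb w2 T) $ j $ k
       - (slice_comb w2 T ** adjugate (slice_comb w0 T) ** slice_comb w1 T) $ j $ k) = 0"
proof (cases "det (slice_comb w0 T) = 0")
  case False
  obtain B C :: "complex ^ 'm ^ 'm" and d where
    BDC: "\<And>w. slice_comb w T = B ** (\<chi> i j. if i = j then d w i else 0) ** C"
    using slice_comb_factor[of a b c, folded assms] by blast
  define D :: "complex ^ 'a \<Rightarrow> complex ^ 'm ^ 'm" where "D w = (\<chi> i j. if i = j then d w i else 0)" for w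
  have fac: "slice_comb w T = B ** D w ** C" for w by (simp add: BDC D_def)
  \<comment> \<open>Multiplicativity of the determinant: one invertible slice forces all three of
    its factors to be invertible.\<close>
  have "det B \<noteq> 0" "det (D w0) \<noteq> 0" "det C \<noteq> 0"
    using False by (auto simp: fac det_mul)
  then obtain B' C' D' where inv: "B' ** B = mat 1" "B ** B' = mat 1" "C' ** C = mat 1" "C ** C' = mat 1"
    "D w0 ** D' = mat 1" "D' ** D w0 = mat 1"
    by (metis invertible_det_nz invertible_def)
  have Dcomm: "D u ** D v = D v ** D u" for u v
    by (simp add: D_def matrix_matrix_mult_def vec_eq_iff if_distrib[of "\<lambda>x. _ * x"] cong: if_cong)
  have cancel: "U ** B' ** B = U" "U ** B ** B' = U" "U ** C' ** C = U" "U ** C ** C' = U"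
    "U ** D w0 ** D' = U" "U ** D' ** D w0 = U" for U :: "complex ^ 'm ^ 'm"
    by (simp_all add: inv flip: matrix_mul_assoc)
  have D': "D w ** D' = D' ** D w" for w
  proof -
    have "D' ** D w = D' ** (D w ** D w0) ** D'" by (simp add: matrix_mul_assoc cancel)
    also have "\<dots> = D' ** (D w0 ** D w) ** D'" by (simp only: Dcomm)
    also have "\<dots> = D w ** D'" by (simp add: matrix_mul_assoc inv)
    finally show ?thesis by simp
  qed
  \<comment> \<open>The inverse of the slice at \<open>w0\<close>. Between two slices its outer
    factors cancel \<open>C\<close> and \<open>B\<close>, leaving a product of commuting
    matrices.\<close>
  define N where "N = C' ** D' ** B'"
  have MN: "slice_comb w0 T ** N = mat 1"
    by (simp add: N_def fac matrix_mul_assoc cancel inv)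
  have comm: "slice_comb w1 T ** N ** slice_comb w2 T = slice_comb w2 T ** N ** slice_comb w1 T"
  proof -
    have e: "slice_comb u T ** N ** slice_comb v T = B ** (D u ** D' ** D v) ** C" for u v
      by (simp add: N_def fac matrix_mul_assoc cancel)
    have "D u ** D' ** D v = D v ** D' ** D u" for u v
      by (simp only: D' matrix_mul_assoc[symmetric] Dcomm[of u v])
    then show ?thesis unfolding e by simp
  qed
  show ?thesis
    by (simp add: adjugate_eq_det_inverse[OF MN] comm)
qed simp

text \<open>The identity for tensors of rank \<open>m\<close> cuts out a closed set, which therefore
  contains \<open>T\<close>. At \<open>T\<close> the determinant of \<open>M0\<close> is nonzero and
  can be divided out.\<close>

lemma strassen_commutation:
  fixes T :: "('a::finite, 'm::finite, 'm) tensor"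
  assumes "border_rank T = CARD('m)"
    and "M0 \<in> tensor_image T" "M1 \<in> tensor_image T" "M2 \<in> tensor_image T" and N: "M0 ** N = mat 1"
  shows "M1 ** N ** M2 = M2 ** N ** M1"
proof -
  obtain w0 w1 w2 where w: "M0 = slice_comb w0 T" "M1 = slice_comb w1 T" "M2 = slice_comb w2 T"
    using assms(2-4) by (auto simp: tensor_image_eq_range)
  let ?F = "\<lambda>j k (S :: ('a, 'm, 'm) tensor). det (slice_comb w0 S) *
      ((slice_comb w1 S ** adjugate (slice_comb w0 S) ** slice_comb w2 S) $ j $ k
       - (slice_comb w2 S ** adjugate (slice_comb w0 S) ** slice_comb w1 S) $ j $ k)"
  \<comment> \<open>Border rank is the least element of a nonempty set, so it is attained.\<close>
  have T: "T \<in> closure {S. tensor_rank S = CARD('m)}"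
    using LeastI_ex[OF ex_border_rank[of T]] assms(1) by (simp add: border_rank_def)
  have "?F j k T = 0" for j k
  proof -
    have sc: "continuous_on UNIV (\<lambda>S :: ('a, 'm, 'm) tensor. slice_comb w S $ j $ k)" for w j k
      unfolding slice_comb_def vec_lambda_beta by (intro continuous_intros)
    have cont: "continuous_on UNIV (?F j k)"
      by (intro continuous_on_mult continuous_on_diff continuous_on_det continuous_on_matrix_mult_entry
          continuous_on_adjugate_entry sc)
    then have "closed {S. ?F j k S = 0}"
      by (intro closed_Collect_eq continuous_on_const)
    moreover have "{S. tensor_rank S = CARD('m)} \<subseteq> {S. ?F j k S = 0}"
    proof
      fix S :: "('a, 'm, 'm) tensor" assume "S \<in> {S. tensor_rank S = CARD('m)}"
      then have "\<exists>a b c. S = (\<Sum>l<CARD('m). tensor3 (a l) (b l) (c l))"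
        using LeastI_ex[OF ex_tensor_decomposition[of S]] by (auto simp: tensor_rank_def)
      then show "S \<in> {S. ?F j k S = 0}" using strassen_adjugate_rank by blast
    qed
    ultimately have "closure {S. tensor_rank S = CARD('m)} \<subseteq> {S. ?F j k S = 0}"
      by (rule closure_minimal[rotated])
    then show ?thesis using T by blast
  qed
  moreover have d: "det M0 \<noteq> 0"
    using N invertible_det_nz invertible_right_inverse by blast
  \<comment> \<open>The factor \<open>det M0\<close> is cancelled twice: here the explicit one, then
    the one hidden in the adjugate.\<close>
  ultimately have "M1 ** adjugate M0 ** M2 = M2 ** adjugate M0 ** M1"
    by (simp add: w vec_eq_iff)
  then show ?thesis
    using d by (simp add: adjugate_eq_det_inverse[OF N])
qed

section \<open>Pencils with a tangent hyperplane\<close>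

text \<open>Bilinear, without conjugation. For \<open>N\<close> inverse to \<open>M0\<close> it is a
  perfect pairing of \<open>C\<close> with \<open>B\<close>.\<close>

definition pairing :: "complex ^ 'm ^ 'n \<Rightarrow> complex ^ 'n \<Rightarrow> complex ^ 'm::finite \<Rightarrow> complex" where
  "pairing N c x = (\<Sum>k\<in>UNIV. c $ k * (N *v x) $ k)"

lemma pairing_simps [simp]:
  "pairing N (c + d) x = pairing N c x + pairing N d x"
  "pairing N (c - d) x = pairing N c x - pairing N d x"
  "pairing N (s *s c) x = s * pairing N c x"
  "pairing N 0 x = 0"
  "pairing N c (x + y) = pairing N c x + pairing N c y"
  "pairing N c (x - y) = pairing N c x - pairing N c y"
  "pairing N c (s *s x) = s * pairing N c x"
  "pairing N c 0 = 0"
  by (simp_all add: pairing_def algebra_simps sum.distrib sum_subtractf sum_distrib_left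
      matrix_vector_right_distrib matrix_vector_mult_diff_distrib vector_scalar_commute)

lemma pairing_sum_left: "pairing N (\<Sum>i\<in>I. f i) x = (\<Sum>i\<in>I. pairing N (f i) x)"
  by (induction I rule: infinite_finite_induct) simp_all

lemma pairing_sum_right: "pairing N c (\<Sum>i\<in>I. f i) = (\<Sum>i\<in>I. pairing N c (f i))"
  by (induction I rule: infinite_finite_induct) simp_all

section \<open>Products of rank one matrices\<close>

lemma matrix_add_rdistrib: "(A + B) ** C = A ** C + B ** (C :: 'a::semiring_1 ^ 'n ^ 'm)"
  by (simp add: matrix_matrix_mult_def vec_eq_iff algebra_simps sum.distrib)

lemma matrix_diff_rdistrib: "(A - B) ** C = A ** C - B ** (C :: 'a::ring_1 ^ 'n ^ 'm)"
  by (simp add: matrix_matrix_mult_def vec_eq_iff algebra_simps sum_subtractf)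

lemma tensor2_simps:
  "tensor2 (b + b') c = tensor2 b c + tensor2 b' c"
  "tensor2 b (c + c') = tensor2 b c + tensor2 b c'"
  "tensor2 (b - b') c = tensor2 b c - tensor2 b' c"
  "tensor2 b (c - c') = tensor2 b c - tensor2 b c'"
  "tensor2 (s *s b) c = mat_scale s (tensor2 b c)"
  "tensor2 b (s *s c) = mat_scale s (tensor2 b c)"
  by (simp_all add: tensor2_def vec_eq_iff algebra_simps)

lemma tensor2_mult_vector: "(tensor2 b c ** N) *v x = pairing N c x *s b"
proof -
  have "tensor2 b c *v y = (\<Sum>k\<in>UNIV. c $ k * y $ k) *s b" for y
    by (simp add: tensor2_def matrix_vector_mult_def vec_eq_iff sum_distrib_left mult_ac)
  then show ?thesis by (simp add: pairing_def flip: matrix_vector_mul_assoc)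
qed

text \<open>Turns commutation between sums of rank one matrices into equations between pairings and
  vectors.\<close>

lemma tensor2_mult_tensor2:
  fixes b :: "complex ^ 'a" and N :: "complex ^ 'b ^ 'c"
  shows "tensor2 b c ** N ** tensor2 b' c' = mat_scale (pairing N c b') (tensor2 b c')"
proof -
  have "A ** tensor2 b' c' = tensor2 (A *v b') c'" for A :: "complex ^ 'b ^ 'a"
    by (simp add: tensor2_def matrix_matrix_mult_def matrix_vector_mult_def vec_eq_iff
        sum_distrib_left sum_distrib_right mult_ac)
  then show ?thesis by (simp add: tensor2_mult_vector tensor2_simps)
qed

lemma tensor2_eq_0_iff: "tensor2 b c = 0 \<longleftrightarrow> b = 0 \<or> c = 0"
  by (auto simp: tensor2_def vec_eq_iff)

text \<open>The subspaces \<open>b \<otimes> C\<close> and \<open>B \<otimes> c\<close> meet only in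
  the line of \<open>b \<otimes> c\<close>.\<close>

lemma tensor2_eq_tensor2:
  assumes "tensor2 b u = tensor2 v c" "b \<noteq> 0" "c \<noteq> 0"
  obtains t where "v = t *s b" "u = t *s c"
proof -
  have e: "b $ j * u $ k = v $ j * c $ k" for j k
    using assms(1) by (simp add: tensor2_def vec_eq_iff)
  obtain k where k: "c $ k \<noteq> 0" using \<open>c \<noteq> 0\<close> by (auto simp: vec_eq_iff)
  obtain j where j: "b $ j \<noteq> 0" using \<open>b \<noteq> 0\<close> by (auto simp: vec_eq_iff)
  have v: "v = (u $ k / c $ k) *s b"
    using e[of _ k] k by (simp add: vec_eq_iff field_simps)
  moreover have "u = (u $ k / c $ k) *s c"
    using e[of j] j k by (simp add: v vec_eq_iff field_simps)
  ultimately show thesis using that by blast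
qed

text \<open>Gram-Schmidt for a symmetric bilinear form. Isotropic vectors are the obstacle: if the
  complement of the vectors found so far had no others, polarisation would put it into the radical
  and \<open>W\<close> would be too small. Symmetry is asked on \<open>W\<close> only, since it will
  come from commutation inside \<open>E\<close>.\<close>

lemma orthonormal_family_mod_radical:
  fixes scale :: "complex \<Rightarrow> 'v \<Rightarrow> 'v::ab_group_add" and Q :: "'v \<Rightarrow> 'v \<Rightarrow> complex"
  assumes "vector_space scale" and W: "module.subspace scale W"
    and add: "\<And>x y z. Q (x + y) z = Q x z + Q y z" and mult: "\<And>t x z. Q (scale t x) z = t * Q x z"
    and sym: "\<And>x y. x \<in> W \<Longrightarrow> y \<in> W \<Longrightarrow> Q x y = Q y x"
    and rad: "\<And>x. x \<in> W \<Longrightarrow> (\<And>y. y \<in> W \<Longrightarrow> Q x y = 0) \<Longrightarrow> x \<in> module.span scale {r}"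
    and n: "n < vector_space.dim scale W"
  shows "\<exists>e. \<forall>i<n::nat. e i \<in> W \<and> (\<forall>j<n. Q (e i) (e j) = (if i = j then 1 else 0))"
  using n
proof (induction n)
  case 0
  then show ?case by simp
next
  case (Suc n)
  interpret vector_space scale by fact
  from Suc obtain e where e: "\<And>i. i < n \<Longrightarrow> e i \<in> W"
    and ee: "\<And>i j. i < n \<Longrightarrow> j < n \<Longrightarrow> Q (e i) (e j) = (if i = j then 1 else 0)" by auto
  have add': "Q z (x + y) = Q z x + Q z y" and mult': "Q z (scale t x) = t * Q z x"
    if "x \<in> W" "y \<in> W" "z \<in> W" for x y z t
    using sym[of z] that W by (simp_all add: subspace_add subspace_scale add mult)
  have minus: "Q (x - y) z = Q x z - Q y z" for x y z
    using add[of "x - y" y z] by simp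
  have zero: "Q 0 z = 0" for z using mult[of 0 0 z] by simp
  have Qsum: "Q (\<Sum>i\<in>I. f i) z = (\<Sum>i\<in>I. Q (f i) z)" for I and f :: "nat \<Rightarrow> 'v" and z
    by (induction I rule: infinite_finite_induct) (simp_all add: add zero)
  \<comment> \<open>The orthogonal projection onto the span of the vectors already found.\<close>
  define p where "p x = (\<Sum>i<n. scale (Q x (e i)) (e i))" for x
  have pW: "p x \<in> W" for x
    unfolding p_def using e W by (intro subspace_sum subspace_scale) auto
  have xpW: "x - p x \<in> W" if "x \<in> W" for x using that pW W by (simp add: subspace_diff)
  have orth: "Q (x - p x) (e j) = 0" if "x \<in> W" "j < n" for x j
  proof -
    have "(\<Sum>i<n. Q x (e i) * Q (e i) (e j)) = (\<Sum>i<n. if i = j then Q x (e i) else 0)"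
      using that by (intro sum.cong) (simp_all add: ee)
    then show ?thesis using that by (simp add: minus p_def Qsum mult)
  qed
  have "\<exists>x\<in>W. Q (x - p x) (x - p x) \<noteq> 0"
  proof (rule ccontr)
    assume "\<not> ?thesis"
    then have iso: "Q (x - p x) (x - p x) = 0" if "x \<in> W" for x using that by blast
    \<comment> \<open>Polarisation: the form vanishes on the complement once all its vectors are
      isotropic.\<close>
    have iso2: "Q (x - p x) (y - p y) = 0" if "x \<in> W" "y \<in> W" for x y
    proof -
      have "(x + y) - p (x + y) = (x - p x) + (y - p y)"
        by (simp add: p_def add scale_left_distrib sum.distrib)
      then have "Q ((x - p x) + (y - p y)) ((x - p x) + (y - p y)) = 0"
        using iso[of "x + y"] that W by (simp only: subspace_add)
      then have "2 * Q (x - p x) (y - p y) = 0"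
        using iso[OF that(1)] iso[OF that(2)] sym[OF xpW[OF that(1)] xpW[OF that(2)]] xpW that
        by (simp add: add add' W subspace_add)
      then show ?thesis by simp
    qed
    \<comment> \<open>\<open>x - p x\<close> is orthogonal to the complement by \<open>iso2\<close>
      and to each \<open>e i\<close> by construction, so it lies in the radical. Hence
      \<open>n + 1\<close> vectors span \<open>W\<close>, against
      \<open>Suc n < dim W\<close>.\<close>
    have "x \<in> span (insert r (e ` {..<n}))" if x: "x \<in> W" for x
    proof -
      have "Q (x - p x) y = 0" if y: "y \<in> W" for y
      proof -
        have "Q (x - p x) (p y) = Q (p y) (x - p x)" using sym xpW[OF x] pW by blast
        also have "\<dots> = (\<Sum>i<n. Q y (e i) * Q (x - p x) (e i))"
          unfolding p_def[of y] Qsum mult using sym xpW[OF x] e by simp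
        also have "\<dots> = 0" using orth[OF x] by simp
        finally show ?thesis
          using iso2[OF x y] add'[of "y - p y" "p y" "x - p x"] xpW x y pW by simp
      qed
      then have "x - p x \<in> span {r}" using rad xpW x by blast
      moreover have "p x \<in> span (e ` {..<n})"
        unfolding p_def by (intro span_sum span_scale span_base) auto
      ultimately have "(x - p x) + p x \<in> span (insert r (e ` {..<n}))"
        by (intro span_add) (meson span_mono subsetD insert_subset empty_subsetI insertI1 subset_insertI)+
      then show ?thesis by simp
    qed
    then have "dim W \<le> card (insert r (e ` {..<n}))" by (intro dim_le_card) auto
    also have "\<dots> \<le> Suc (card (e ` {..<n}))" by (simp add: card_insert_le_m1 card_insert_if)
    also have "\<dots> \<le> Suc n" using card_image_le[of "{..<n}" e] by simp
    finally show False using Suc.prems by simp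
  qed
  then obtain x where x: "x \<in> W" "Q (x - p x) (x - p x) \<noteq> 0" by blast
  \<comment> \<open>A complex square root scales any non-isotropic vector to
    \<open>Q y y = 1\<close>.\<close>
  define y where "y = scale (1 / csqrt (Q (x - p x) (x - p x))) (x - p x)"
  have yW: "y \<in> W" using x xpW W by (simp add: y_def subspace_scale)
  have ye: "Q y (e j) = 0" if "j < n" for j using orth[OF x(1) that] by (simp add: y_def mult)
  have ey: "Q (e j) y = 0" if "j < n" for j using ye[OF that] sym[OF yW e[OF that]] by simp
  have "Q y y = 1 / csqrt (Q (x - p x) (x - p x)) ^ 2 * Q (x - p x) (x - p x)"
    using mult'[of "x - p x" "x - p x" "x - p x"] x xpW
    by (simp add: y_def mult power2_eq_square)
  then have yy: "Q y y = 1" using x by simp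
  show ?case
    by (rule exI[of _ "e(n := y)"]) (auto simp: less_Suc_eq yW ye ey yy e ee)
qed

text \<open>The linear data extracted from \<open>T\<close>: \<open>E\<close> is the image,
  \<open>tensor2 b c\<close> represents the point of the Segre variety, \<open>W\<close> is the
  tangent hyperplane and \<open>comm\<close> is Strassen's condition.\<close>

locale tangent_pencil =
  fixes E W :: "(complex ^ 'm ^ 'm::finite) set" and M0 N :: "complex ^ 'm ^ 'm" and b c :: "complex ^ 'm"
    and q :: nat
  assumes E: "matsp.subspace E" and M0: "M0 \<in> E" and MN: "M0 ** N = mat 1"
    and comm: "\<And>M M'. M \<in> E \<Longrightarrow> M' \<in> E \<Longrightarrow> M ** N ** M' = M' ** N ** M"
    and W: "matsp.subspace W" and WE: "W \<subseteq> E" and dimW: "matsp.dim W = Suc q"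
    and q: "0 < q" and card: "CARD('m) = q + 2"
    and b0: "b \<noteq> 0" and c0: "c \<noteq> 0" and XW: "tensor2 b c \<in> W"
    and tangent: "\<And>M. M \<in> W \<Longrightarrow> \<exists>c' b'. M = tensor2 b c' + tensor2 b' c"
    and rank1: "\<And>u w. tensor2 u w \<in> E \<Longrightarrow> \<exists>t. tensor2 u w = mat_scale t (tensor2 b c)"
begin

section \<open>Nondegeneracy of the pairing\<close>

lemma NM: "N ** M0 = mat 1"
  using MN matrix_left_right_inverse by blast

lemma pairing_M0: "pairing N d (M0 *v u) = (\<Sum>k\<in>UNIV. d $ k * u $ k)"
  by (simp add: pairing_def matrix_vector_mul_assoc NM)

lemma pairing_nondegenerate_left:
  assumes "\<And>x. pairing N d x = 0" shows "d = 0"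
proof -
  have "d $ k = 0" for k
    using assms[of "M0 *v axis k 1"] by (simp add: pairing_M0 axis_def if_distrib cong: if_cong)
  then show ?thesis by (simp add: vec_eq_iff)
qed

lemma ex_dual_left: assumes "d \<noteq> 0" obtains v where "pairing N d v = 1"
proof -
  obtain x where "pairing N d x \<noteq> 0" using pairing_nondegenerate_left assms by blast
  then show thesis using that[of "(1 / pairing N d x) *s x"] by simp
qed

lemma ex_dual_right: assumes "x \<noteq> 0" obtains d where "pairing N d x = 1"
proof -
  have "N *v x \<noteq> 0"
    using assms MN by (metis matrix_vector_mul_assoc matrix_vector_mul_lid matrix_vector_mult_0_right)
  then obtain k where "(N *v x) $ k \<noteq> 0" by (auto simp: vec_eq_iff)
  then have "pairing N (axis k (1 / (N *v x) $ k)) x = 1"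
    by (simp add: pairing_def axis_def if_distrib if_distribR cong: if_cong)
  then show thesis by (rule that)
qed

lemma scale_tensor2_bc_eq_iff: "mat_scale s (tensor2 b c) = mat_scale t (tensor2 b c) \<longleftrightarrow> s = t"
  using matsp.scale_right_imp_eq[of "tensor2 b c" s t] b0 c0 by (auto simp: tensor2_eq_0_iff)

text \<open>Under either proportionality the two summands merge into a single
  \<open>tensor2\<close>, and \<open>rank1\<close> leaves only multiples of
  \<open>tensor2 b c\<close>.\<close>

lemma tensor2_in_W_prop:
  assumes "tensor2 b c' + tensor2 b' c \<in> W" "b' = t *s b \<or> c' = t *s c"
  shows "tensor2 b c' + tensor2 b' c \<in> matsp.span {tensor2 b c}"
proof -
  have "\<exists>u w. tensor2 b c' + tensor2 b' c = tensor2 u w"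
    using assms(2)
  proof
    assume "b' = t *s b"
    then have "tensor2 b c' + tensor2 b' c = tensor2 b (c' + t *s c)" by (simp add: tensor2_simps)
    then show ?thesis by blast
  next
    assume "c' = t *s c"
    then have "tensor2 b c' + tensor2 b' c = tensor2 (b' + t *s b) c" by (simp add: tensor2_simps)
    then show ?thesis by blast
  qed
  then show ?thesis using rank1 assms(1) WE by (fastforce simp: matsp.span_singleton)
qed

section \<open>Vanishing of the pairings of \<open>b\<close> and \<open>c\<close> with tangent
  directions\<close>

lemma W_not_subset_span:
  assumes "finite S" "card S \<le> q" shows "\<not> W \<subseteq> matsp.span S"
  using matsp.dim_le_card[of W S] assms dimW by auto

text \<open>Otherwise commuting \<open>tensor2 b c\<close> with any element of \<open>W\<close>
  makes \<open>b'\<close> a multiple of \<open>b\<close>. Then \<open>W\<close> is a single line,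
  while its dimension is at least 2.\<close>

lemma pairing_c_b: "pairing N c b = 0"
proof (rule ccontr)
  assume nz: "pairing N c b \<noteq> 0"
  have "W \<subseteq> matsp.span {tensor2 b c}"
  proof
    fix M assume M: "M \<in> W"
    obtain c' b' where M': "M = tensor2 b c' + tensor2 b' c" using tangent M by blast
    have "tensor2 b c ** N ** M = M ** N ** tensor2 b c" using comm XW M WE by blast
    then have "tensor2 b (pairing N c b *s c' + pairing N c b' *s c) =
        tensor2 (pairing N c' b *s b + pairing N c b *s b') c"
      by (simp add: M' matrix_add_ldistrib matrix_add_rdistrib tensor2_mult_tensor2 tensor2_simps)
    then obtain t where "pairing N c' b *s b + pairing N c b *s b' = t *s b"
      using tensor2_eq_tensor2 b0 c0 by metis
    then have "b' = ((t - pairing N c' b) / pairing N c b) *s b"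
      using nz by (simp add: vec_eq_iff field_simps)
    then show "M \<in> matsp.span {tensor2 b c}" using tensor2_in_W_prop M M' by blast
  qed
  then show False using W_not_subset_span[of "{tensor2 b c}"] q by simp
qed

lemma pairing_eq:
  assumes "tensor2 b c' + tensor2 b' c \<in> W" shows "pairing N c b' = pairing N c' b"
proof -
  have "tensor2 b c ** N ** (tensor2 b c' + tensor2 b' c) = (tensor2 b c' + tensor2 b' c) ** N ** tensor2 b c"
    using comm XW assms WE by blast
  then show ?thesis
    by (simp add: matrix_add_ldistrib matrix_add_rdistrib tensor2_mult_tensor2 pairing_c_b
        scale_tensor2_bc_eq_iff tensor2_eq_0_iff b0 c0)
qed

text \<open>Subtracting a multiple of the given element from \<open>K\<close> achieves
  \<open>pairing N c d = 0\<close>. Commutation then makes \<open>d\<close> a multiple of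
  \<open>b\<close>, so the remainder is a multiple of \<open>tensor2 b c\<close>.\<close>

lemma W_subset_span_pair:
  assumes "tensor2 b c1 + tensor2 b1 c \<in> W" "pairing N c b1 = 1"
  shows "W \<subseteq> matsp.span {tensor2 b c, tensor2 b c1 + tensor2 b1 c}"
proof
  let ?P = "tensor2 b c1 + tensor2 b1 c"
  fix K assume K: "K \<in> W"
  obtain c' b' where K': "K = tensor2 b c' + tensor2 b' c" using tangent K by blast
  define r where "r = pairing N c b'"
  define k where "k = c' - r *s c1"
  define d where "d = b' - r *s b1"
  have Kr: "K - mat_scale r ?P = tensor2 b k + tensor2 d c"
    by (simp add: K' k_def d_def tensor2_simps matsp.scale_right_distrib)
  have KrW: "K - mat_scale r ?P \<in> W"
    using K assms(1) W by (simp add: matsp.subspace_diff matsp.subspace_scale)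
  have pd: "pairing N c d = 0" using assms(2) by (simp add: d_def r_def)
  then have pk: "pairing N k b = 0" using pairing_eq KrW Kr by simp
  have p1: "pairing N c1 b = 1" using pairing_eq[OF assms(1)] assms(2) by simp
  have "(tensor2 b k + tensor2 d c) ** N ** ?P = ?P ** N ** (tensor2 b k + tensor2 d c)"
    using comm KrW assms(1) WE unfolding Kr by blast
  then have "tensor2 (pairing N k b1 *s b + d) c = tensor2 b (k + pairing N c1 d *s c)"
    by (simp add: matrix_add_ldistrib matrix_add_rdistrib tensor2_mult_tensor2 tensor2_simps
        pairing_c_b pd pk p1 assms(2) add.commute)
  then obtain t where "pairing N k b1 *s b + d = t *s b"
    using tensor2_eq_tensor2[OF sym] b0 c0 by metis
  then have "d = (t - pairing N k b1) *s b"
    by (simp add: vec_eq_iff algebra_simps)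
  then have "K - mat_scale r ?P \<in> matsp.span {tensor2 b c}"
    using tensor2_in_W_prop KrW Kr by metis
  then have "K - mat_scale r ?P \<in> matsp.span {tensor2 b c, ?P}"
    by (meson matsp.span_mono subsetD subset_insertI empty_subsetI insert_mono)
  moreover have "mat_scale r ?P \<in> matsp.span {tensor2 b c, ?P}"
    by (intro matsp.span_scale matsp.span_base) simp
  ultimately have "(K - mat_scale r ?P) + mat_scale r ?P \<in> matsp.span {tensor2 b c, ?P}"
    by (rule matsp.span_add)
  then show "K \<in> matsp.span {tensor2 b c, ?P}" by simp
qed

text \<open>Otherwise \<open>m = 3\<close>, and \<open>P N\<close> is (after subtracting a multiple of \<open>X\<close>) a projection of
  rank 2, so that \<open>M\<^sub>0 - P\<close> is another element of \<open>E\<close> of rank one.\<close>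

lemma pairing_c_eq_0:
  assumes M: "tensor2 b c' + tensor2 b' c \<in> W" shows "pairing N c b' = 0"
proof (rule ccontr)
  assume nz: "pairing N c b' \<noteq> 0"
  define b1 where "b1 = (1 / pairing N c b') *s b'"
  define c2 where "c2 = (1 / pairing N c b') *s c'"
  \<comment> \<open>This subtracts a multiple of \<open>tensor2 b c\<close> from the tangent
    element, so that \<open>c1\<close> annihilates \<open>b1\<close>; then \<open>P ** N\<close>
    fixes both \<open>b\<close> and \<open>b1\<close>.\<close>
  define c1 where "c1 = c2 - pairing N c2 b1 *s c"
  define P where "P = tensor2 b c1 + tensor2 b1 c"
  have "P = mat_scale (1 / pairing N c b') (tensor2 b c' + tensor2 b' c)
      - mat_scale (pairing N c2 b1) (tensor2 b c)"
    by (simp add: P_def b1_def c1_def c2_def tensor2_simps matsp.scale_right_distrib)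
  then have PW: "P \<in> W"
    using M XW W by (simp add: matsp.subspace_diff matsp.subspace_scale del: matsp.scale_right_diff_distrib)
  have cb1: "pairing N c b1 = 1" using nz by (simp add: b1_def)
  have c1b: "pairing N c1 b = 1" using pairing_eq PW cb1 unfolding P_def by simp
  have c1b1: "pairing N c1 b1 = 0" by (simp add: c1_def cb1)
  have "W \<subseteq> matsp.span {tensor2 b c, P}"
    using W_subset_span_pair PW cb1 unfolding P_def by blast
  then have "\<not> card {tensor2 b c, P} \<le> q"
    using W_not_subset_span[of "{tensor2 b c, P}"] by blast
  moreover have "card {tensor2 b c, P} \<le> 2" by (simp add: card_insert_if)
  ultimately have q1: "q = 1" using q by linarith
  have small: "vec.span S \<noteq> (UNIV :: (complex ^ 'm) set)" if "finite S" "card S < 3" for S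
    using vec.dim_le_card[of "UNIV :: (complex ^ 'm) set" S] that card q1
    by (auto simp: card_cart_basis vec.dimension_def vec_dim_card)
  have "card {b, b1} < 3" by (simp add: card_insert_if)
  then have "\<exists>w. w \<notin> vec.span {b, b1}"
    using small[of "{b, b1}"] by auto
  then obtain w where w: "w \<notin> vec.span {b, b1}" by blast
  have "b1 \<notin> vec.span {b}"
    using cb1 pairing_c_b by (auto simp: vec.span_singleton)
  then have ind: "vec.independent {w, b1, b}"
    using b0 w by (intro vec.independent_insertI) (auto simp: insert_commute vec.independent_empty)
  have card3: "card {w, b1, b} = 3"
    using w \<open>b1 \<notin> vec.span {b}\<close> vec.span_base[of _ "{b, b1}"] vec.span_base[of _ "{b}"] 
    by (auto simp: card_insert_if)
  have "vec.span {w, b1, b} = UNIV"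
    using vec.card_eq_dim[of "{w, b1, b}" UNIV] ind card3 card q1
    by (simp add: vec_dim_card card_cart_basis top.extremum_unique)
  define R where "R = M0 - P"
  \<comment> \<open>\<open>M0 ** N\<close> is the identity, so \<open>R ** N\<close> kills what
    \<open>P ** N\<close> fixes. Only the third basis vector \<open>w\<close> can survive, and the
    rank is at most one.\<close>
  have Rb: "(R ** N) *v b = 0" "(R ** N) *v b1 = 0"
    by (simp_all add: R_def P_def matrix_diff_rdistrib MN matrix_vector_mult_diff_rdistrib
        matrix_add_rdistrib matrix_vector_mult_add_rdistrib tensor2_mult_vector c1b c1b1 pairing_c_b cb1)
  have "(R ** N) *v x \<in> vec.span {(R ** N) *v w}" for x
  proof -
    have "(R ** N) *v x \<in> (*v) (R ** N) ` vec.span {w, b1, b}"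
      using \<open>vec.span {w, b1, b} = UNIV\<close> by simp
    then have "(R ** N) *v x \<in> vec.span ((*v) (R ** N) ` {w, b1, b})"
      by (simp only: vec.linear_span_image[OF matrix_vector_mul_linear_gen])
    then show ?thesis by (simp add: Rb insert_commute)
  qed
  then have "\<exists>t. (R ** N) *v x = t *s ((R ** N) *v w)" for x
    by (auto simp: vec.span_singleton)
  \<comment> \<open>Since \<open>R = (R ** N) ** M0\<close>, the columns of \<open>R\<close> lie in
    the image of \<open>R ** N\<close>.\<close>
  then have "\<exists>t. R *v axis k 1 = t *s ((R ** N) *v w)" for k
    by (metis NM matrix_mul_assoc matrix_mul_rid matrix_vector_mul_assoc)
  then obtain \<phi> where \<phi>: "\<And>k. R *v axis k 1 = \<phi> k *s ((R ** N) *v w)" by metis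
  have "R = tensor2 ((R ** N) *v w) (\<chi> k. \<phi> k)"
  proof -
    have "R $ j $ k = (R *v axis k 1) $ j" for j k
      by (simp add: matrix_vector_mult_def axis_def if_distrib cong: if_cong)
    then show ?thesis by (simp add: \<phi> tensor2_def vec_eq_iff mult.commute)
  qed
  moreover have "R \<in> E" using M0 PW WE E unfolding R_def by (auto intro: matsp.subspace_diff)
  ultimately obtain t where "R = mat_scale t (tensor2 b c)" using rank1 by metis
  \<comment> \<open>Now the identity \<open>M0 ** N\<close> would map everything into the span of
    \<open>b\<close> and \<open>b1\<close>, which misses \<open>w\<close>.\<close>
  then have M0': "M0 = P + mat_scale t (tensor2 b c)" by (simp add: R_def algebra_simps)
  have "x \<in> vec.span {b, b1}" for x
  proof -
    have "x = (M0 ** N) *v x" by (simp add: MN)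
    also have "\<dots> = (pairing N c1 x + t * pairing N c x) *s b + pairing N c x *s b1"
      by (simp add: M0' P_def matrix_add_rdistrib matrix_vector_mult_add_rdistrib tensor2_mult_vector
          algebra_simps vec_eq_iff)
    also have "\<dots> \<in> vec.span {b, b1}"
      by (intro vec.span_add vec.span_scale vec.span_base) auto
    finally show ?thesis .
  qed
  then show False using w by blast
qed

section \<open>The symmetric form on the tangent hyperplane\<close>

text \<open>Of the four products of summands, three carry a vanishing pairing with \<open>b\<close>
  or \<open>c\<close>.\<close>

lemma W_product:
  assumes "tensor2 b c1 + tensor2 b1 c \<in> W" "tensor2 b c2 + tensor2 b2 c \<in> W"
  shows "(tensor2 b c1 + tensor2 b1 c) ** N ** (tensor2 b c2 + tensor2 b2 c) =
    mat_scale (pairing N c1 b2) (tensor2 b c)"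
  using pairing_c_eq_0[OF assms(1)] pairing_c_eq_0[OF assms(2)] pairing_eq[OF assms(1)] pairing_eq[OF assms(2)]
  by (simp add: matrix_add_ldistrib matrix_add_rdistrib tensor2_mult_tensor2 pairing_c_b)

text \<open>For \<open>v\<close> with \<open>pairing N c v = 1\<close> the map \<open>M \<mapsto> M N v\<close> is injective on \<open>W\<close>. If \<open>M\<close> is in
  the radical of the form, the image is killed by both \<open>c\<close> and \<open>c1\<close>; by dimension
  these functionals are proportional.\<close>

lemma W_radical:
  assumes M: "M \<in> W" and rad: "\<And>M'. M' \<in> W \<Longrightarrow> M ** N ** M' = 0"
  shows "M \<in> matsp.span {tensor2 b c}"
proof -
  obtain c1 b1 where M1: "M = tensor2 b c1 + tensor2 b1 c" using tangent M by blast
  obtain v where v: "pairing N c v = 1" using ex_dual_left c0 .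
  define L where "L K = (K ** N) *v v" for K :: "complex ^ 'm ^ 'm"
  interpret L: Vector_Spaces.linear mat_scale "(*s)" L
    by unfold_locales
      (simp_all add: L_def matrix_add_rdistrib matrix_vector_mult_add_rdistrib vec_eq_iff algebra_simps)
  have L_tensor2: "L (tensor2 b c' + tensor2 b' c) = pairing N c' v *s b + b'" for c' b'
    by (simp add: L_def matrix_add_rdistrib matrix_vector_mult_add_rdistrib tensor2_mult_vector v)
  \<comment> \<open>A kernel element has \<open>b'\<close> proportional to \<open>b\<close>, hence
    is a multiple of \<open>tensor2 b c\<close>, which \<open>L\<close> sends to the same multiple
    of \<open>b\<close>.\<close>
  have inj0: "K = 0" if K: "K \<in> W" "L K = 0" for K
  proof -
    obtain c' b' where K': "K = tensor2 b c' + tensor2 b' c" using tangent K by blast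
    then have "pairing N c' v *s b + b' = 0" using K(2) L_tensor2 by simp
    then have "b' = (- pairing N c' v) *s b"
      by (simp add: vec_eq_iff algebra_simps add_eq_0_iff)
    then have "K \<in> matsp.span {tensor2 b c}" using tensor2_in_W_prop K(1) K' by metis
    then obtain s where s: "K = mat_scale s (tensor2 b c)" by (auto simp: matsp.span_singleton)
    then have "s *s b = 0" using K(2) by (simp add: L.scale) (simp add: L_def tensor2_mult_vector v)
    then show "K = 0" using s b0 by simp
  qed
  have inj: "inj_on L W"
  proof (rule inj_onI)
    fix x y assume "x \<in> W" "y \<in> W" "L x = L y"
    then show "x = y" using inj0[of "x - y"] W by (simp add: L.diff matsp.subspace_diff)
  qed
  obtain B where B: "B \<subseteq> W" "matsp.independent B" "W \<subseteq> matsp.span B" "card B = Suc q"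
    using matsp.basis_exists[of W] dimW by auto
  have finB: "finite B" using B(4) card.infinite by fastforce
  have spanB: "matsp.span B = W" using B W by (simp add: matsp.span_minimal subset_antisym)
  have indL: "vec.independent (L ` B)"
    using L.independent_injective_image[OF B(2)] inj spanB by simp
  have cardL: "card (L ` B) = Suc q"
    using card_image[of L B] inj_on_subset[OF inj B(1)] B(4) by simp
  have ann: "pairing N c x = 0" "pairing N c1 x = 0" if "x \<in> L ` B" for x
  proof -
    obtain K where K: "K \<in> W" "x = L K" using \<open>x \<in> L ` B\<close> B(1) by blast
    obtain c' b' where K': "K = tensor2 b c' + tensor2 b' c" using tangent K by blast
    have x: "x = pairing N c' v *s b + b'" using K K' L_tensor2 by simp
    show "pairing N c x = 0" using pairing_c_eq_0 K(1) K' by (simp add: x pairing_c_b)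
    have "mat_scale (pairing N c1 b') (tensor2 b c) = 0"
      using W_product rad[OF K(1)] M K(1) unfolding M1 K' by metis
    then have "pairing N c1 b' = 0" using b0 c0 by (simp add: tensor2_eq_0_iff)
    moreover have "pairing N c1 b = 0"
      using pairing_eq pairing_c_eq_0 M unfolding M1 by metis
    ultimately show "pairing N c1 x = 0" by (simp add: x)
  qed
  have "vec.span (L ` B) \<subseteq> {x. pairing N c x = 0}"
    using ann by (intro vec.span_minimal) (auto simp: vec.subspace_def)
  then have v': "v \<notin> vec.span (L ` B)" using v by auto
  \<comment> \<open>\<open>c\<close> annihilates the \<open>q + 1\<close> independent images but not
    \<open>v\<close>, so together they form a basis.\<close>
  then have "vec.independent (insert v (L ` B))" using indL by (simp add: vec.independent_insert)
  moreover have "card (insert v (L ` B)) = CARD('m)"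
    using v' finB cardL card vec.span_base[of v "L ` B"] by (auto simp: card_insert_if)
  ultimately have full: "vec.span (insert v (L ` B)) = UNIV"
    using vec.card_eq_dim[of "insert v (L ` B)" UNIV] finB
    by (simp add: vec_dim_card card_cart_basis top.extremum_unique)
  \<comment> \<open>The combination of \<open>c1\<close> and \<open>c\<close> that also annihilates
    \<open>v\<close> vanishes on a basis.\<close>
  have "vec.span (insert v (L ` B)) \<subseteq> {x. pairing N (c1 - pairing N c1 v *s c) x = 0}"
    using ann v by (intro vec.span_minimal) (auto simp: vec.subspace_def algebra_simps)
  then have "c1 - pairing N c1 v *s c = 0"
    using full by (intro pairing_nondegenerate_left) auto
  then have "c1 = pairing N c1 v *s c" by simp
  then show ?thesis using tensor2_in_W_prop M M1 by blast
qed

text \<open>Since \<open>W\<close> has dimension \<open>q + 1\<close> and the radical lies in one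
  line, \<open>q\<close> orthonormal vectors fit.\<close>

lemma ex_orthonormal_tangents:
  obtains C B :: "nat \<Rightarrow> complex ^ 'm"
  where "\<And>i. i < q \<Longrightarrow> tensor2 b (C i) + tensor2 (B i) c \<in> W"
    and "\<And>i j. i < q \<Longrightarrow> j < q \<Longrightarrow> pairing N (C i) (B j) = (if i = j then 1 else 0)"
proof -
  obtain p r where pr: "tensor2 b c $ p $ r \<noteq> 0"
    using b0 c0 tensor2_eq_0_iff[of b c] by (metis vec_eq_iff zero_index)
  \<comment> \<open>On \<open>W\<close> the product is a multiple of \<open>tensor2 b c\<close>; a
    nonzero entry reads off the factor, independently of how elements of \<open>W\<close> are
    decomposed.\<close>
  define Q where "Q M M' = (M ** N ** M') $ p $ r / tensor2 b c $ p $ r" for M M' :: "complex ^ 'm ^ 'm"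
  have Q: "Q (tensor2 b c1 + tensor2 b1 c) (tensor2 b c2 + tensor2 b2 c) = pairing N c1 b2"
    if "tensor2 b c1 + tensor2 b1 c \<in> W" "tensor2 b c2 + tensor2 b2 c \<in> W" for c1 c2 b1 b2
    using W_product[OF that] pr by (simp add: Q_def)
  have "\<exists>e. \<forall>i<q. e i \<in> W \<and> (\<forall>j<q. Q (e i) (e j) = (if i = j then 1 else 0))"
  proof (rule orthonormal_family_mod_radical[where scale = mat_scale and r = "tensor2 b c"])
    show "vector_space mat_scale" by (rule matsp.vector_space_axioms)
    show "matsp.subspace W" by (rule W)
    show "q < matsp.dim W" by (simp add: dimW)
    show "Q (x + y) z = Q x z + Q y z" for x y z
      by (simp add: Q_def matrix_add_rdistrib add_divide_distrib)
    show "Q (mat_scale t x) z = t * Q x z" for t x z by (simp add: Q_def)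
    show "Q x y = Q y x" if "x \<in> W" "y \<in> W" for x y
      using comm that WE by (simp add: Q_def subset_iff)
    show "x \<in> matsp.span {tensor2 b c}" if x: "x \<in> W" and rad: "\<And>y. y \<in> W \<Longrightarrow> Q x y = 0" for x
    proof (rule W_radical[OF x])
      fix y assume y: "y \<in> W"
      obtain c1 b1 c2 b2 where "x = tensor2 b c1 + tensor2 b1 c" "y = tensor2 b c2 + tensor2 b2 c"
        using tangent x y by metis
      then show "x ** N ** y = 0" using rad[OF y] Q W_product x y by fastforce
    qed
  qed
  then obtain e where e: "\<And>i. i < q \<Longrightarrow> e i \<in> W"
    and ee: "\<And>i j. i < q \<Longrightarrow> j < q \<Longrightarrow> Q (e i) (e j) = (if i = j then 1 else 0)" by blast
  have "\<forall>i. \<exists>c' b'. i < q \<longrightarrow> e i = tensor2 b c' + tensor2 b' c" using tangent e by blast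
  then obtain C B where CB: "\<And>i. i < q \<Longrightarrow> e i = tensor2 b (C i) + tensor2 (B i) c" by metis
  show thesis
  proof (rule that)
    show "tensor2 b (C i) + tensor2 (B i) c \<in> W" if "i < q" for i using e CB that by metis
    then show "pairing N (C i) (B j) = (if i = j then 1 else 0)" if "i < q" "j < q" for i j
      using that Q ee CB by metis
  qed
qed

text \<open>The transposition reflects that \<open>b\<close> and \<open>c\<close> pair to zero:
  \<open>C 0\<close> is dual to the last \<open>B\<close> and the last \<open>C\<close> to
  \<open>B 0\<close>, as in the first slice of the Coppersmith-Winograd tensor.\<close>

lemma ex_cw_bases:
  obtains B C :: "nat \<Rightarrow> complex ^ 'm"
  where "\<And>p l. p < q + 2 \<Longrightarrow> l < q + 2 \<Longrightarrow>
      pairing N (C (Transposition.transpose 0 (Suc q) p)) (B l) = (if p = l then 1 else 0)"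
    and "tensor2 (B 0) (C 0) \<in> E"
    and "\<And>j. j \<in> {1..q} \<Longrightarrow> tensor2 (B 0) (C j) + tensor2 (B j) (C 0) \<in> E"
proof -
  obtain C0 B0 where CW: "\<And>i. i < q \<Longrightarrow> tensor2 b (C0 i) + tensor2 (B0 i) c \<in> W"
    and CB: "\<And>i j. i < q \<Longrightarrow> j < q \<Longrightarrow> pairing N (C0 i) (B0 j) = (if i = j then 1 else 0)"
    using ex_orthonormal_tangents by metis
  have cB: "pairing N c (B0 i) = 0" if "i < q" for i using pairing_c_eq_0 CW that by blast
  have Cb: "pairing N (C0 i) b = 0" if "i < q" for i using cB[OF that] pairing_eq[OF CW[OF that]] by simp
  obtain v where v: "pairing N c v = 1" using ex_dual_left c0 .
  obtain d where d: "pairing N d b = 1" using ex_dual_right b0 .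
  \<comment> \<open>Dual partners of \<open>c\<close> and \<open>b\<close>, made orthogonal to the
    \<open>C0 i\<close> and \<open>B0 i\<close>; \<open>cq\<close> is finally corrected by
    \<open>c\<close> to annihilate \<open>bq\<close>.\<close>
  define bq where "bq = v - (\<Sum>i<q. pairing N (C0 i) v *s B0 i)"
  define d1 where "d1 = d - (\<Sum>i<q. pairing N d (B0 i) *s C0 i)"
  define cq where "cq = d1 - pairing N d1 bq *s c"
  have c_bq: "pairing N c bq = 1" by (simp add: bq_def v pairing_sum_right cB)
  have C_bq: "pairing N (C0 i) bq = 0" if "i < q" for i
  proof -
    have "(\<Sum>j<q. pairing N (C0 j) v * pairing N (C0 i) (B0 j)) = (\<Sum>j<q. if j = i then pairing N (C0 j) v else 0)"
      using that by (intro sum.cong) (auto simp: CB)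
    then show ?thesis using that by (simp add: bq_def pairing_sum_right)
  qed
  have d1_b: "pairing N d1 b = 1" by (simp add: d1_def d pairing_sum_left Cb)
  have d1_B: "pairing N d1 (B0 i) = 0" if "i < q" for i
  proof -
    have "(\<Sum>j<q. pairing N d (B0 j) * pairing N (C0 j) (B0 i)) = (\<Sum>j<q. if j = i then pairing N d (B0 j) else 0)"
      using that by (intro sum.cong) (auto simp: CB)
    then show ?thesis using that by (simp add: d1_def pairing_sum_left)
  qed
  have cq: "pairing N cq b = 1" "pairing N cq bq = 0" "i < q \<Longrightarrow> pairing N cq (B0 i) = 0" for i
    by (simp_all add: cq_def d1_b d1_B pairing_c_b cB c_bq)
  \<comment> \<open>The orthonormal family is numbered from 0, its copies in \<open>B\<close> and
    \<open>C\<close> from 1.\<close>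
  define B where "B l = (if l = 0 then b else if l \<le> q then B0 (l - 1) else bq)" for l
  define C where "C l = (if l = 0 then c else if l \<le> q then C0 (l - 1) else cq)" for l
  show thesis
  proof (rule that)
    show "tensor2 (B 0) (C 0) \<in> E" using XW WE by (auto simp: B_def C_def)
    show "tensor2 (B 0) (C j) + tensor2 (B j) (C 0) \<in> E" if "j \<in> {1..q}" for j
      using CW[of "j - 1"] that WE by (auto simp: B_def C_def)
    show "pairing N (C (Transposition.transpose 0 (Suc q) p)) (B l) = (if p = l then 1 else 0)"
      if "p < q + 2" "l < q + 2" for p l
    proof -
      have cases: "k = 0 \<or> (\<exists>i<q. k = Suc i) \<or> k = Suc q" if "k < q + 2" for k
        using that by (cases k) (auto simp: less_Suc_eq)
      show ?thesis
        using cases[OF \<open>p < q + 2\<close>] cases[OF \<open>l < q + 2\<close>]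
        by (elim disjE exE conjE; simp add: B_def C_def Transposition.transpose_def cq c_bq C_bq cB Cb CB pairing_c_b)
    qed
  qed
qed

end

section \<open>Reduction to the Coppersmith-Winograd tensor\<close>

lemma gl_act_add: "gl_act g h k (S + T) = gl_act g h k S + gl_act g h k T"
  by (simp add: gl_act_def vec_eq_iff algebra_simps sum.distrib)

lemma gl_act_0: "gl_act g h k 0 = 0"
  by (simp add: gl_act_def vec_eq_iff)

lemma gl_act_sum: "gl_act g h k (\<Sum>l\<in>L. S l) = (\<Sum>l\<in>L. gl_act g h k (S l))"
  by (induction L rule: infinite_finite_induct) (simp_all add: gl_act_add gl_act_0)

lemma gl_act_compose:
  "gl_act g h k (gl_act g' h' k' T) = gl_act (g ** g') (h ** h') (k ** k') T"
proof -
  obtain r a b c where "T = (\<Sum>l<r::nat. tensor3 (a l) (b l) (c l))"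
    using ex_tensor_decomposition by blast
  then show ?thesis by (simp add: gl_act_sum gl_act_tensor3 matrix_vector_mul_assoc)
qed

lemma gl_act_cw_tensor:
  "gl_act g h k (cw_tensor q a b c) =
    cw_tensor q (\<lambda>l. g *v a l) (\<lambda>l. h *v b l) (\<lambda>l. k *v c l)"
  by (simp add: cw_tensor_def gl_act_add gl_act_sum gl_act_tensor3)

lemma cw_tensor_cong:
  assumes "\<And>l. l < q + 2 \<Longrightarrow> a l = a' l" "\<And>l. l < q + 2 \<Longrightarrow> b l = b' l" "\<And>l. l < q + 2 \<Longrightarrow> c l = c' l"
  shows "cw_tensor q a b c = cw_tensor q a' b' c'"
proof -
  have "(\<Sum>j=1..q. tensor3 (a 0) (b j) (c j) + tensor3 (a j) (b 0) (c j) + tensor3 (a j) (b j) (c 0)) =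
    (\<Sum>j=1..q. tensor3 (a' 0) (b' j) (c' j) + tensor3 (a' j) (b' 0) (c' j) + tensor3 (a' j) (b' j) (c' 0))"
    by (intro sum.cong) (simp_all add: assms)
  then show ?thesis by (simp add: cw_tensor_def assms)
qed

definition cw_slice :: "nat \<Rightarrow> (nat \<Rightarrow> complex ^ 'b) \<Rightarrow> (nat \<Rightarrow> complex ^ 'c) \<Rightarrow> nat \<Rightarrow> (complex ^ 'c) ^ 'b" where
  "cw_slice q b c l =
    (if l = 0 then (\<Sum>j=1..q. tensor2 (b j) (c j)) + tensor2 (b 0) (c (q+1)) + tensor2 (b (q+1)) (c 0)
     else if l \<le> q then tensor2 (b 0) (c l) + tensor2 (b l) (c 0)
     else tensor2 (b 0) (c 0))"

text \<open>With a standard basis in the first factor, numbered by \<open>f\<close>, the coordinates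
  of the tensor are its slices.\<close>

lemma cw_tensor_axis_nth:
  fixes f :: "'m::finite \<Rightarrow> nat"
  assumes f: "bij_betw f UNIV {..<q + 2}"
  shows "cw_tensor q (\<lambda>l. axis (inv f l) 1) b c $ i = cw_slice q b c (f i)"
proof -
  have inv: "i = inv f l \<longleftrightarrow> f i = l" if "l < q + 2" for l
    using f that by (metis bij_betw_def f_inv_into_f inv_f_f lessThan_iff)
  have t: "tensor3 (axis (inv f l) 1) u w $ i = (if f i = l then tensor2 u w else 0)"
    if "l < q + 2" for l and u w :: "complex ^ 'm"
    using inv[OF that] by (simp add: tensor3_def tensor2_def axis_def vec_eq_iff)
  have fi: "f i < q + 2" using f by (auto simp: bij_betw_def)
  have "cw_tensor q (\<lambda>l. axis (inv f l) 1) b c $ i =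
     (\<Sum>j=1..q. (if f i = 0 then tensor2 (b j) (c j) else 0) +
       (if f i = j then tensor2 (b 0) (c j) else 0) + (if f i = j then tensor2 (b j) (c 0) else 0))
     + (if f i = 0 then tensor2 (b 0) (c (q+1)) else 0) + (if f i = 0 then tensor2 (b (q+1)) (c 0) else 0)
     + (if f i = q + 1 then tensor2 (b 0) (c 0) else 0)"
    unfolding cw_tensor_def by (simp add: t)
  also have "\<dots> = cw_slice q b c (f i)"
    using fi by (auto simp: cw_slice_def sum.distrib)
  finally show ?thesis .
qed

lemma gl_act_first_factor: "gl_act g (mat 1) (mat 1) T $ i = slice_comb (g $ i) T"
proof -
  have "(\<Sum>p\<in>UNIV. \<Sum>q\<in>UNIV. \<Sum>s\<in>UNIV. g $ i $ p * mat 1 $ j $ q * mat 1 $ l $ s * T $ p $ q $ s) =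
      (\<Sum>p\<in>UNIV. g $ i $ p * T $ p $ j $ l)" for j l
  proof (intro sum.cong refl)
    fix p
    show "(\<Sum>q\<in>UNIV. \<Sum>s\<in>UNIV. g $ i $ p * mat 1 $ j $ q * mat 1 $ l $ s * T $ p $ q $ s) =
        g $ i $ p * T $ p $ j $ l"
      by (simp add: mat_def if_distrib[of "\<lambda>x. _ * x"] if_distrib[of "\<lambda>x. x * _"] cong: if_cong)
  qed
  then show ?thesis by (simp add: gl_act_def slice_comb_def vec_eq_iff)
qed

definition column_matrix :: "('m \<Rightarrow> nat) \<Rightarrow> (nat \<Rightarrow> complex ^ 'n) \<Rightarrow> complex ^ 'm ^ 'n" where
  "column_matrix f v = (\<chi> j i. v (f i) $ j)"

lemma column_matrix_axis: "column_matrix f v *v axis i 1 = v (f (i :: 'm::finite))"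
  by (simp add: column_matrix_def matrix_vector_mult_def axis_def vec_eq_iff if_distrib cong: if_cong)

lemma invertible_column_matrix:
  fixes v :: "nat \<Rightarrow> complex ^ 'm::finite"
  assumes "indexed_basis n v" "bij_betw f (UNIV :: 'm set) {..<n}"
  shows "invertible (column_matrix f v)"
proof -
  have "columns (column_matrix f v) = v ` range f"
    by (auto simp: columns_def column_def column_matrix_def image_def vec_lambda_eta)
  also have "range f = {..<n}" using assms(2) by (simp add: bij_betw_def)
  finally have "vec.span (columns (column_matrix f v)) = UNIV"
    using assms(1) by (simp add: indexed_basis_def)
  then show ?thesis
    by (simp add: invertible_right_inverse matrix_right_invertible_span_columns)
qed

lemma ex_change_of_basis:
  fixes u v :: "nat \<Rightarrow> complex ^ 'm::finite"
  assumes f: "bij_betw f (UNIV :: 'm set) {..<n}"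
    and u: "invertible (column_matrix f u)" and v: "invertible (column_matrix f v)"
  obtains h where "invertible h" "\<And>l. l < n \<Longrightarrow> h *v u l = v l"
proof -
  obtain U where U: "U ** column_matrix f u = mat 1" "column_matrix f u ** U = mat 1"
    using u by (auto simp: invertible_def)
  show thesis
  proof (rule that)
    have "invertible U" using U by (auto simp: invertible_def)
    then show "invertible (column_matrix f v ** U)" using v invertible_mult by blast
    fix l assume "l < n"
    then have "f (inv f l) = l" using f by (metis bij_betw_def f_inv_into_f lessThan_iff)
    then have e: "column_matrix f w *v axis (inv f l) 1 = w l" for w :: "nat \<Rightarrow> complex ^ 'm"
      by (simp add: column_matrix_axis)
    have "U *v u l = axis (inv f l) 1"
      unfolding e[of u, symmetric] by (simp add: matrix_vector_mul_assoc U)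
    then show "(column_matrix f v ** U) *v u l = v l"
      by (simp add: e flip: matrix_vector_mul_assoc)
  qed
qed

lemma invertible_transpose_iff: "invertible (transpose A) \<longleftrightarrow> invertible (A :: 'a::field ^ 'n ^ 'n::finite)"
  by (metis invertible_left_inverse invertible_right_inverse left_invertible_transpose)

lemma subspace_tensor_image: "matsp.subspace (tensor_image T)"
proof -
  have "slice_comb 0 T = 0" "slice_comb (u + w) T = slice_comb u T + slice_comb w T"
    "slice_comb (t *s u) T = mat_scale t (slice_comb u T)" for t u w
    by (simp_all add: slice_comb_def vec_eq_iff algebra_simps sum.distrib sum_distrib_left)
  then show ?thesis
    unfolding matsp.subspace_def tensor_image_eq_range
    by (auto simp: image_iff) metis+
qed

text \<open>For fixed \<open>x\<close> this is linear in \<open>w\<close>, so independence of the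
  resulting vectors passes back to the coefficient vectors.\<close>

lemma slice_comb_mult_vector:
  "slice_comb w T *v x = (\<chi> j i. (T $ i *v x) $ j) *v w"
  by (simp add: slice_comb_def matrix_vector_mult_def vec_eq_iff sum_distrib_left sum_distrib_right mult_ac)
    (intro allI sum.swap)

locale cw_pencil = tangent_pencil E W M0 N b c q
  for E W :: "(complex ^ 'm ^ 'm::finite) set" and M0 N b c q +
  fixes B C :: "nat \<Rightarrow> complex ^ 'm"
  assumes dual: "\<And>p l. p < q + 2 \<Longrightarrow> l < q + 2 \<Longrightarrow>
      pairing N (C (Transposition.transpose 0 (Suc q) p)) (B l) = (if p = l then 1 else 0)"
    and XE: "tensor2 (B 0) (C 0) \<in> E"
    and YE: "\<And>j. j \<in> {1..q} \<Longrightarrow> tensor2 (B 0) (C j) + tensor2 (B j) (C 0) \<in> E"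
begin

abbreviation swap where "swap \<equiv> Transposition.transpose 0 (Suc q)"

section \<open>The slices in dual bases\<close>

lemma swap_bij: "bij_betw f UNIV {..<q + 2} \<Longrightarrow> bij_betw (swap \<circ> f) UNIV {..<q + 2}"
  by (rule bij_betw_trans) (auto intro: bij_betw_byWitness[where f' = swap] simp: Transposition.transpose_def)

lemma dual_matrices:
  fixes f :: "'m \<Rightarrow> nat"
  assumes f: "bij_betw f UNIV {..<q + 2}"
  shows "transpose (column_matrix (swap \<circ> f) C) ** N ** column_matrix f B = mat 1"
proof -
  have fl: "f i < q + 2" for i using f by (auto simp: bij_betw_def)
  have fi: "f i = f j \<longleftrightarrow> i = j" for i j using f by (auto simp: bij_betw_def inj_eq)
  have "(transpose (column_matrix (swap \<circ> f) C) ** N ** column_matrix f B) $ i $ j = pairing N (C (swap (f i))) (B (f j))" for i j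
    unfolding matrix_mul_assoc[symmetric]
    by (simp add: pairing_def matrix_matrix_mult_def matrix_vector_mult_def transpose_def column_matrix_def)
  then show ?thesis by (simp add: vec_eq_iff mat_def dual[OF fl fl] fi)
qed

lemma invertible_B: assumes f: "bij_betw f (UNIV :: 'm set) {..<q + 2}" shows "invertible (column_matrix f B)"
  using dual_matrices[OF f] invertible_left_inverse by blast

text \<open>Duality is applied to the numbering \<open>swap \<circ> f\<close>; as
  \<open>swap\<close> is an involution, the columns of \<open>C\<close> return to the order
  \<open>f\<close>.\<close>

lemma invertible_C: assumes f: "bij_betw f (UNIV :: 'm set) {..<q + 2}" shows "invertible (column_matrix f C)"
proof -
  have "swap \<circ> (swap \<circ> f) = f" by (simp add: fun_eq_iff)
  then have "transpose (column_matrix f C) ** (N ** column_matrix (swap \<circ> f) B) = mat 1"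
    using dual_matrices[OF swap_bij[OF f]] by (simp add: matrix_mul_assoc)
  then show ?thesis
    using invertible_right_inverse invertible_transpose_iff by blast
qed

text \<open>The inverse of a pairing is the sum of the tensors of dual basis vectors;
  \<open>swap\<close> crosses the terms 0 and \<open>q + 1\<close>.\<close>

lemma M0_eq: "M0 = cw_slice q B C 0"
proof -
  obtain f :: "'m \<Rightarrow> nat" where "bij_betw f UNIV {0..<CARD('m)}"
    using ex_bij_betw_finite_nat[of "UNIV :: 'm set"] by auto
  then have f: "bij_betw f UNIV {..<q + 2}" by (simp add: atLeast0LessThan card)
  have "column_matrix f B ** (transpose (column_matrix (swap \<circ> f) C) ** N) = mat 1"
    using dual_matrices[OF f] matrix_left_right_inverse by blast
  then have "column_matrix f B ** transpose (column_matrix (swap \<circ> f) C) ** (N ** M0) = M0"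
    by (simp add: matrix_mul_assoc)
  then have "M0 = column_matrix f B ** transpose (column_matrix (swap \<circ> f) C)" by (simp add: NM)
  also have "\<dots> = (\<Sum>i\<in>UNIV. tensor2 (B (f i)) (C (swap (f i))))"
    by (simp add: vec_eq_iff matrix_matrix_mult_def transpose_def column_matrix_def tensor2_def)
  also have "\<dots> = (\<Sum>l<q + 2. tensor2 (B l) (C (swap l)))"
    by (rule sum.reindex_bij_betw[OF f])
  also have "{..<q + 2} = insert 0 (insert (q + 1) {1..q})" by auto
  also have "(\<Sum>l\<in>insert 0 (insert (q + 1) {1..q}). tensor2 (B l) (C (swap l))) =
      tensor2 (B 0) (C (q + 1)) + (tensor2 (B (q + 1)) (C 0) + (\<Sum>l=1..q. tensor2 (B l) (C (swap l))))"
    by simp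
  also have "(\<Sum>l=1..q. tensor2 (B l) (C (swap l))) = (\<Sum>l=1..q. tensor2 (B l) (C l))"
    by (intro sum.cong) (auto simp: Transposition.transpose_def)
  finally show ?thesis by (simp add: cw_slice_def add_ac)
qed

lemma cw_slice_in_E: "cw_slice q B C l \<in> E"
proof (cases "l = 0")
  case True
  then show ?thesis using M0 M0_eq by simp
next
  case False
  then show ?thesis using XE YE[of l] by (auto simp: cw_slice_def)
qed

text \<open>\<open>B (q + 1)\<close> is annihilated by every \<open>C k\<close> except
  \<open>C 0\<close>. The distinct basis vectors obtained show that the slices are
  independent.\<close>

lemma cw_slice_mult_last:
  assumes l: "l < q + 2" shows "(cw_slice q B C l ** N) *v B (q + 1) = B (swap l)"
proof -
  have p: "pairing N (C k) (B (Suc q)) = (if k = 0 then 1 else 0)" if "k < q + 2" for k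
    using dual[of "Suc q" "Suc q"] dual[of 0 "Suc q"] dual[of k "Suc q"] that
    by (auto simp: Transposition.transpose_def split: if_splits)
  have "l = 0 \<or> l \<in> {1..q} \<or> l = q + 1" using l by auto
  then consider "l = 0" | "l \<in> {1..q}" | "l = q + 1" by blast
  then show ?thesis
  proof cases
    case 1
    then show ?thesis using M0_eq MN by simp
  next
    case 2
    then show ?thesis
      by (simp add: cw_slice_def matrix_add_rdistrib matrix_vector_mult_add_rdistrib tensor2_mult_vector
          p[of l] p[of 0] Transposition.transpose_def)
  next
    case 3
    then show ?thesis by (simp add: cw_slice_def tensor2_mult_vector p)
  qed
qed

lemma isomorphic_cw_tensor:
  assumes ET: "E = tensor_image T"
    and a: "indexed_basis (q + 2) a'" and b: "indexed_basis (q + 2) b'" and c: "indexed_basis (q + 2) c'"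
  shows "tensor_isomorphic T (cw_tensor q a' b' c')"
proof -
  obtain f :: "'m \<Rightarrow> nat" where "bij_betw f UNIV {0..<CARD('m)}"
    using ex_bij_betw_finite_nat[of "UNIV :: 'm set"] by auto
  then have f: "bij_betw f UNIV {..<q + 2}" by (simp add: atLeast0LessThan card)
  have fl: "f i < q + 2" for i using f by (auto simp: bij_betw_def)
  have "\<forall>l. \<exists>w. l < q + 2 \<longrightarrow> cw_slice q B C l = slice_comb w T"
    using cw_slice_in_E by (auto simp: ET tensor_image_eq_range)
  then obtain w where w: "\<And>l. l < q + 2 \<Longrightarrow> cw_slice q B C l = slice_comb (w l) T"
    unfolding choice_iff by blast
  define g where "g = (\<chi> i. w (f i))"
  define R where "R = (\<chi> j i. (T $ i *v (N *v B (q + 1))) $ j)"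
  have "R *v w (f i) = B (swap (f i))" for i
    using cw_slice_mult_last[OF fl[of i]]
    by (simp add: R_def w[OF fl] flip: slice_comb_mult_vector matrix_vector_mul_assoc)
  \<comment> \<open>The right-hand side is invertible, so the coefficient vectors
    \<open>w (f i)\<close>, the rows of \<open>g\<close>, form a basis.\<close>
  then have "R ** transpose g = column_matrix (swap \<circ> f) B"
    by (simp add: g_def vec_eq_iff matrix_matrix_mult_def matrix_vector_mult_def column_matrix_def transpose_def)
  then have "invertible (transpose g)"
    using invertible_B[OF swap_bij[OF f]] by (metis invertible_left_inverse matrix_mul_assoc)
  then have g: "invertible g" by (simp add: invertible_transpose_iff)
  \<comment> \<open>\<open>g\<close> alone brings \<open>T\<close> into Coppersmith-Winograd form;
    afterwards only the three bases are exchanged for the given ones.\<close>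
  have T1: "gl_act g (mat 1) (mat 1) T = cw_tensor q (\<lambda>l. axis (inv f l) 1) B C"
    by (rule iffD2[OF vec_eq_iff], rule allI)
      (simp add: gl_act_first_factor cw_tensor_axis_nth[OF f, simplified] w[OF fl] g_def)
  obtain h where h: "invertible h" "\<And>l. l < q + 2 \<Longrightarrow> h *v B l = b' l"
    using ex_change_of_basis[OF f invertible_B[OF f] invertible_column_matrix[OF b f]]
    by blast
  obtain k where k: "invertible k" "\<And>l. l < q + 2 \<Longrightarrow> k *v C l = c' l"
    using ex_change_of_basis[OF f invertible_C[OF f] invertible_column_matrix[OF c f]]
    by blast
  have A: "column_matrix f a' *v axis (inv f l) 1 = a' l" if "l < q + 2" for l
    using f that by (metis bij_betw_def column_matrix_axis f_inv_into_f lessThan_iff)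
  have "gl_act (column_matrix f a' ** g) h k T = gl_act (column_matrix f a') h k (gl_act g (mat 1) (mat 1) T)"
    by (simp add: gl_act_compose)
  also have "\<dots> = cw_tensor q a' b' c'"
    unfolding T1 gl_act_cw_tensor by (intro cw_tensor_cong) (simp_all add: A h k)
  finally have "permute_factors id (gl_act (column_matrix f a' ** g) h k T) = cw_tensor q a' b' c'"
    by (simp add: permute_factors_def vec_eq_iff)
  then show ?thesis
    unfolding tensor_isomorphic_def
    using invertible_mult[OF invertible_column_matrix[OF a f] g] h(1) k(1) permutes_id by blast
qed

end

section \<open>From projective to linear conditions\<close>

lemma proj_point_eqD:
  assumes "proj_point Y = proj_point X" obtains t where "Y = mat_scale t X"
  using assms matsp.span_base[of Y "{Y}"] by (auto simp: proj_point_def matsp.span_singleton)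

text \<open>Closure under scaling makes membership independent of the representative of the
  point.\<close>

lemma mem_projectivization_iff:
  assumes "\<And>t M. M \<in> V \<Longrightarrow> mat_scale t M \<in> V" "M \<noteq> 0"
  shows "proj_point M \<in> projectivization V \<longleftrightarrow> M \<in> V"
  using assms by (auto simp: projectivization_def elim!: proj_point_eqD)

theorem theorem7p4:
  fixes T :: "('m::finite, 'm, 'm) tensor"
    and X :: "(complex ^ 'm) ^ 'm"
    and a b c :: "nat \<Rightarrow> complex ^ 'm"
    and m :: nat
  assumes "CARD('m) = m" and "m > 2"
    and "border_rank T = m"
    and "one_A_generic T"
    and "projectivization (tensor_image T) \<inter> segre = {proj_point X}"
    and "is_linear_proj_space (m - 2)
           (projectivization (segre_tangent X) \<inter> projectivization (tensor_image T))"
    and "indexed_basis m a" and "indexed_basis m b" and "indexed_basis m c"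
  shows "tensor_isomorphic T (cw_tensor (m - 2) a b c)"
proof -
  define E where "E = tensor_image T"
  define q where "q = m - 2"
  have m: "m = q + 2" using assms(2) by (simp add: q_def)
  have E: "matsp.subspace E" unfolding E_def by (rule subspace_tensor_image)
  have E_scale: "mat_scale t M \<in> E" if "M \<in> E" for t M using E that by (rule matsp.subspace_scale)
  obtain M0 where M0: "M0 \<in> E" "rank M0 = CARD('m)"
    using assms(4) by (auto simp: one_A_generic_def E_def)
  obtain N where MN: "M0 ** N = mat 1"
    using full_rank_imp_invertible[OF M0(2)] by (auto simp: invertible_def)
  have "proj_point X \<in> segre" "proj_point X \<in> projectivization E" using assms(5) by (auto simp: E_def)
  then obtain b1 c1 where bc1: "b1 \<noteq> 0" "c1 \<noteq> 0" "proj_point X = proj_point (tensor2 b1 c1)"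
    by (auto simp: segre_def)
  obtain z where z: "X = mat_scale z (tensor2 b1 c1)" using proj_point_eqD[OF bc1(3)] .
  obtain z' where z': "tensor2 b1 c1 = mat_scale z' X" using proj_point_eqD[OF bc1(3)[symmetric]] .
  have "tensor2 b1 c1 \<noteq> 0" using bc1 by (simp add: tensor2_eq_0_iff)
  then have X0: "X \<noteq> 0" using z' by auto
  then have z0: "z \<noteq> 0" using z by auto
  \<comment> \<open>The scalar between \<open>X\<close> and its rank one representative is absorbed
    into the first vector.\<close>
  define b0 where "b0 = z *s b1"
  have Xbc: "X = tensor2 b0 c1" by (simp add: z b0_def tensor2_simps)
  have b0: "b0 \<noteq> 0" using z0 bc1 by (simp add: b0_def)
  have tangent_eq: "segre_tangent X = {tensor2 b0 c' + tensor2 b' c1 | b' c'. True}"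
    unfolding Xbc by (rule segre_tangent_tensor2[OF b0 bc1(2)])
  have tangent_scale: "mat_scale t M \<in> segre_tangent X" if "M \<in> segre_tangent X" for t M
  proof -
    obtain b' c' where "M = tensor2 b0 c' + tensor2 b' c1" using \<open>M \<in> segre_tangent X\<close> unfolding tangent_eq by blast
    then have "mat_scale t M = tensor2 b0 (t *s c') + tensor2 (t *s b') c1"
      by (simp add: tensor2_simps matsp.scale_right_distrib)
    then show ?thesis unfolding tangent_eq by blast
  qed
  \<comment> \<open>Projective dimension \<open>m - 2 = q\<close> means linear dimension
    \<open>q + 1\<close>.\<close>
  obtain W where W: "matsp.subspace W" "matsp.dim W = q + 1"
    "projectivization W = projectivization (segre_tangent X) \<inter> projectivization E"
    using assms(6) by (auto simp: is_linear_proj_space_def E_def q_def)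
  have W_scale: "mat_scale t M \<in> W" if "M \<in> W" for t M using W(1) that by (rule matsp.subspace_scale)
  have W_iff: "M \<in> W \<longleftrightarrow> M \<in> segre_tangent X \<and> M \<in> E" if "M \<noteq> 0" for M
    using W(3) mem_projectivization_iff[OF W_scale that] mem_projectivization_iff[OF E_scale that]
      mem_projectivization_iff[OF tangent_scale that] by blast
  have XT: "X \<in> segre_tangent X"
  proof -
    have "X = tensor2 b0 c1 + tensor2 0 c1" by (simp add: Xbc tensor2_def vec_eq_iff)
    then show ?thesis unfolding tangent_eq by blast
  qed
  have XE: "X \<in> E" using mem_projectivization_iff[OF E_scale X0] \<open>proj_point X \<in> projectivization E\<close> by blast
  interpret tangent_pencil E W M0 N b0 c1 q
  proof
    show "matsp.subspace E" by (rule E)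
    show "M0 \<in> E" by (rule M0)
    show "M0 ** N = mat 1" by (rule MN)
    show "M ** N ** M' = M' ** N ** M" if "M \<in> E" "M' \<in> E" for M M'
      using strassen_commutation[of T M0 M M' N] assms(1,3) M0 MN that by (simp add: E_def)
    show "matsp.subspace W" by (rule W)
    show "W \<subseteq> E"
    proof
      fix M assume "M \<in> W"
      then show "M \<in> E" using W_iff[of M] matsp.subspace_0[OF E] by (cases "M = 0") simp_all
    qed
    show "matsp.dim W = Suc q" using W by simp
    show "0 < q" using assms(2) by (simp add: q_def)
    show "CARD('m) = q + 2" using assms(1) m by simp
    show "b0 \<noteq> 0" "c1 \<noteq> 0" by (fact b0 bc1(2))+
    show "tensor2 b0 c1 \<in> W" using W_iff[OF X0] XT XE Xbc by simp
    show "\<exists>c' b'. M = tensor2 b0 c' + tensor2 b' c1" if "M \<in> W" for M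
    proof (cases "M = 0")
      case True
      then have "M = tensor2 b0 0 + tensor2 0 c1" by (simp add: tensor2_def vec_eq_iff)
      then show ?thesis by blast
    next
      case False
      then have "M \<in> segre_tangent X" using W_iff \<open>M \<in> W\<close> by simp
      then show ?thesis unfolding tangent_eq by blast
    qed
    show "\<exists>t. tensor2 u w = mat_scale t (tensor2 b0 c1)" if "tensor2 u w \<in> E" for u w
    proof (cases "tensor2 u w = 0")
      case True
      then show ?thesis by (intro exI[of _ 0]) simp
    next
      case False
      then have "proj_point (tensor2 u w) \<in> projectivization E \<inter> segre"
        using that by (auto simp: projectivization_def segre_def tensor2_eq_0_iff)
      then have "proj_point (tensor2 u w) = proj_point X" using assms(5) by (simp add: E_def)
      then obtain t where "tensor2 u w = mat_scale t X" by (rule proj_point_eqD)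
      then show ?thesis unfolding Xbc by blast
    qed
  qed
  show ?thesis
  proof (rule ex_cw_bases)
    fix B C :: "nat \<Rightarrow> complex ^ 'm"
    assume BC: "\<And>p l. p < q + 2 \<Longrightarrow> l < q + 2 \<Longrightarrow>
        pairing N (C (Transposition.transpose 0 (Suc q) p)) (B l) = (if p = l then 1 else 0)"
      "tensor2 (B 0) (C 0) \<in> E"
      "\<And>j. j \<in> {1..q} \<Longrightarrow> tensor2 (B 0) (C j) + tensor2 (B j) (C 0) \<in> E"
    interpret cw_pencil E W M0 N b0 c1 q B C
      by unfold_locales (fact BC)+
    show ?thesis
      unfolding q_def[symmetric]
      by (rule isomorphic_cw_tensor[OF E_def assms(7-9)[unfolded m]])
  qed
qed

end
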